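(* Let $(\Lambda V, d)$ be a Sullivan minimal model with a Gottlieb element $x \in V^{2n+1}$, let $\theta$ be a derivation cycle of $(\Lambda V,d)$ of degree $2n+1$ with $\theta(x) = 1$, and let $W \subseteq V$ be a graded subspace with $V = \langle x \rangle \oplus W$. Let $\phi \colon \Lambda V \to \Lambda V$ be the automorphism of graded algebras determined by $\phi(x) = x$ and $\phi(v) = v - x\,\theta(v)$ for $v \in W$, and put $d' = \phi^{-1}\circ d\circ\phi$ and $\theta' = \phi^{-1}\circ\theta\circ\phi$. Then: (a) $\theta'(x) = 1$ and $d'(x) = dx$. (b) There is a derivation $\lambda \in \mathrm{Der}_{4n+2}(\Lambda W)$ such that $\theta'(\chi) = x\,\lambda(\chi)$ for all $\chi \in \Lambda W$. (c) There is a derivation $d'_0 \in \mathrm{Der}_{-1}(\Lambda W)$ such that, with $\lambda$ as in (b), for all $\chi \in \Lambda W$, $$d'(\chi) = -\theta'(\chi)\,dx + d'_0(\chi) = -x\,\lambda(\chi)\,dx + d'_0(\chi).$$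
   Context: A (simply connected, finite type) Sullivan minimal model $(\Lambda V, d)$ is a free graded-commutative DG algebra over $\mathbb{Q}$ on a graded vector space $V = \bigoplus_{n \ge 2} V^n$ with each $V^n$ finite-dimensional, with differential $d$ of degree $+1$ whose image lies in the decomposable elements of $\Lambda V$. $\mathrm{Der}_k(\Lambda W)$ denotes the space of derivations of $\Lambda W$ of degree $k$, i.e. linear maps $\theta$ lowering degrees by $k$ (so raising degree by $1$ when $k=-1$) with $\theta(\chi_1\chi_2) = \theta(\chi_1)\chi_2 + (-1)^{k|\chi_1|}\chi_1\theta(\chi_2)$; similarly for $\Lambda V$. A derivation $\theta$ of $\Lambda V$ of degree $k$ is a derivation cycle if $d\theta - (-1)^k\theta d = 0$. An element $v \in V^k$ is a Gottlieb element if there is a derivation cycle $\theta$ of degree $k$ with $\theta(v) = 1$. *)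

theory Defs
  imports
    "HOL.Hull"
    "HOL-Library.FuncSet"
    "HOL-Algebra.Module"
    "HOL-Algebra.AbelCoset"
    "HOL-Algebra.Subrings"
    "HOL-Algebra.Algebraic_Closure_Type"
begin

section \<open>Graded algebras over the rationals\<close>

abbreviation rat_field :: "rat ring" where
  "rat_field \<equiv> ring_of_type_algebra"

text \<open>
  \<^term>\<open>homog A k\<close> is the subspace of elements of degree k. Degrees are integers, so that
  maps of arbitrary integer degree need no truncation.
\<close>

record 'a graded_alg = "(rat, 'a) module" +
  homog :: "int \<Rightarrow> 'a set"

definition rat_algebra :: "'a graded_alg \<Rightarrow> bool" where
  "rat_algebra A \<longleftrightarrow> ring A \<and> module rat_field A \<and>
     (\<forall>q. \<forall>a \<in> carrier A. \<forall>b \<in> carrier A.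
        (q \<odot>\<^bsub>A\<^esub> a) \<otimes>\<^bsub>A\<^esub> b = q \<odot>\<^bsub>A\<^esub> (a \<otimes>\<^bsub>A\<^esub> b) \<and>
        a \<otimes>\<^bsub>A\<^esub> (q \<odot>\<^bsub>A\<^esub> b) = q \<odot>\<^bsub>A\<^esub> (a \<otimes>\<^bsub>A\<^esub> b))"

definition homog_decomp :: "'a graded_alg \<Rightarrow> 'a \<Rightarrow> (int \<Rightarrow> 'a) \<Rightarrow> bool" where
  "homog_decomp A a c \<longleftrightarrow>
     (\<forall>k. c k \<in> homog A k) \<and> finite {k. c k \<noteq> \<zero>\<^bsub>A\<^esub>} \<and>
     a = (\<Oplus>\<^bsub>A\<^esub>k \<in> {k. c k \<noteq> \<zero>\<^bsub>A\<^esub>}. c k)"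

definition graded_algebra :: "'a graded_alg \<Rightarrow> bool" where
  "graded_algebra A \<longleftrightarrow> rat_algebra A \<and>
     (\<forall>k. submodule (homog A k) rat_field A) \<and>
     (\<forall>a \<in> carrier A. \<exists>!c. homog_decomp A a c) \<and>
     \<one>\<^bsub>A\<^esub> \<in> homog A 0 \<and>
     (\<forall>i j. \<forall>a \<in> homog A i. \<forall>b \<in> homog A j. a \<otimes>\<^bsub>A\<^esub> b \<in> homog A (i + j))"

definition graded_commutative_algebra :: "'a graded_alg \<Rightarrow> bool" where
  "graded_commutative_algebra A \<longleftrightarrow> graded_algebra A \<and>
     (\<forall>i j. \<forall>a \<in> homog A i. \<forall>b \<in> homog A j.
        a \<otimes>\<^bsub>A\<^esub> b = ((-1) powi (i * j)) \<odot>\<^bsub>A\<^esub> (b \<otimes>\<^bsub>A\<^esub> a))"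

definition vspan :: "'a graded_alg \<Rightarrow> 'a set \<Rightarrow> 'a set" where
  "vspan A S = (\<lambda>H. submodule H rat_field A) hull S"

definition finite_dimensional :: "'a graded_alg \<Rightarrow> 'a set \<Rightarrow> bool" where
  "finite_dimensional A U \<longleftrightarrow> (\<exists>S. finite S \<and> S \<subseteq> carrier A \<and> U = vspan A S)"

text \<open>
  A graded subspace is the direct sum of its parts \<^term>\<open>U \<inter> homog A k\<close>, i.e. it contains the
  homogeneous components of its elements.
\<close>

definition graded_subspace :: "'a graded_alg \<Rightarrow> 'a set \<Rightarrow> bool" where
  "graded_subspace A U \<longleftrightarrow> submodule U rat_field A \<and>
     (\<forall>u \<in> U. \<forall>c. homog_decomp A u c \<longrightarrow> (\<forall>k. c k \<in> U))"

definition linear_map_on :: "'a graded_alg \<Rightarrow> 'a set \<Rightarrow> 'b graded_alg \<Rightarrow> ('a \<Rightarrow> 'b) \<Rightarrow> bool" where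
  "linear_map_on A U B f \<longleftrightarrow> f \<in> U \<rightarrow> carrier B \<and>
     (\<forall>u \<in> U. \<forall>v \<in> U. f (u \<oplus>\<^bsub>A\<^esub> v) = f u \<oplus>\<^bsub>B\<^esub> f v) \<and>
     (\<forall>q. \<forall>u \<in> U. f (q \<odot>\<^bsub>A\<^esub> u) = q \<odot>\<^bsub>B\<^esub> f u)"

definition graded_alg_hom :: "'a graded_alg \<Rightarrow> 'b graded_alg \<Rightarrow> ('a \<Rightarrow> 'b) set" where
  "graded_alg_hom A B =
     {f \<in> ring_hom A B. linear_map_on A (carrier A) B f \<and> (\<forall>k. f ` homog A k \<subseteq> homog B k)}"

definition graded_alg_aut :: "'a graded_alg \<Rightarrow> ('a \<Rightarrow> 'a) set" where
  "graded_alg_aut A = {f \<in> graded_alg_hom A A. bij_betw f (carrier A) (carrier A)}"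

section \<open>Free graded-commutative algebras\<close>

text \<open>
  \<^term>\<open>free_on A V\<close>: A is the free graded-commutative algebra on its graded subspace V, by the
  universal property. The test algebras B have carriers in the same type as A. This loses
  nothing: as A is nonzero it contains the rationals, so the type is infinite and contains V;
  the free graded-commutative algebra on V has cardinality at most max(|V|, aleph_0), hence an
  isomorphic copy of it occurs among the B, and the usual uniqueness argument identifies it
  with A. Functions are compared on the carrier only, whence \<^const>\<open>extensional\<close>.
\<close>

definition free_on :: "'a graded_alg \<Rightarrow> 'a set \<Rightarrow> bool" where
  "free_on A V \<longleftrightarrow> graded_commutative_algebra A \<and> \<one>\<^bsub>A\<^esub> \<noteq> \<zero>\<^bsub>A\<^esub> \<and> graded_subspace A V \<and>
     (\<forall>(B :: 'a graded_alg) f. graded_commutative_algebra B \<longrightarrow>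
        linear_map_on A V B f \<longrightarrow> (\<forall>k. f ` (V \<inter> homog A k) \<subseteq> homog B k) \<longrightarrow>
        (\<exists>!g. g \<in> extensional (carrier A) \<and> g \<in> graded_alg_hom A B \<and> (\<forall>v \<in> V. g v = f v)))"

text \<open>
  For a graded subspace W of V, the algebra \<open>\<Lambda>W\<close> is realised inside \<open>\<Lambda>V\<close> as the graded
  subalgebra generated by W.
\<close>

definition gen_subalg :: "'a graded_alg \<Rightarrow> 'a set \<Rightarrow> 'a graded_alg" where
  "gen_subalg A W =
     (let H = (\<lambda>H. subring H A \<and> submodule H rat_field A) hull W
      in A\<lparr>carrier := H, homog := (\<lambda>k. homog A k \<inter> H)\<rparr>)"

section \<open>Derivations and Sullivan minimal models\<close>

text \<open>Derivations of degree k lower degrees by k; a differential has degree -1.\<close>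

definition Der :: "'a graded_alg \<Rightarrow> int \<Rightarrow> ('a \<Rightarrow> 'a) set" where
  "Der A k = {\<theta>. linear_map_on A (carrier A) A \<theta> \<and>
     (\<forall>i. \<theta> ` homog A i \<subseteq> homog A (i - k)) \<and>
     (\<forall>i. \<forall>a \<in> homog A i. \<forall>b \<in> carrier A.
        \<theta> (a \<otimes>\<^bsub>A\<^esub> b) = \<theta> a \<otimes>\<^bsub>A\<^esub> b \<oplus>\<^bsub>A\<^esub> ((-1) powi (k * i)) \<odot>\<^bsub>A\<^esub> (a \<otimes>\<^bsub>A\<^esub> \<theta> b))}"

definition decomposables :: "'a graded_alg \<Rightarrow> 'a set" where
  "decomposables A =
     vspan A {a \<otimes>\<^bsub>A\<^esub> b | a b i j. 0 < i \<and> 0 < j \<and> a \<in> homog A i \<and> b \<in> homog A j}"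

definition sullivan_minimal_model :: "'a graded_alg \<Rightarrow> 'a set \<Rightarrow> ('a \<Rightarrow> 'a) \<Rightarrow> bool" where
  "sullivan_minimal_model A V d \<longleftrightarrow> free_on A V \<and>
     (\<forall>k < 2. V \<inter> homog A k = {\<zero>\<^bsub>A\<^esub>}) \<and>
     (\<forall>k. finite_dimensional A (V \<inter> homog A k)) \<and>
     d \<in> Der A (-1) \<and> (\<forall>a \<in> carrier A. d (d a) = \<zero>\<^bsub>A\<^esub>) \<and>
     d ` carrier A \<subseteq> decomposables A"

definition derivation_cycle ::
    "'a graded_alg \<Rightarrow> ('a \<Rightarrow> 'a) \<Rightarrow> int \<Rightarrow> ('a \<Rightarrow> 'a) \<Rightarrow> bool" where
  "derivation_cycle A d k \<theta> \<longleftrightarrow> \<theta> \<in> Der A k \<and>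
     (\<forall>a \<in> carrier A. d (\<theta> a) \<ominus>\<^bsub>A\<^esub> ((-1) powi k) \<odot>\<^bsub>A\<^esub> \<theta> (d a) = \<zero>\<^bsub>A\<^esub>)"

definition gottlieb_element ::
    "'a graded_alg \<Rightarrow> 'a set \<Rightarrow> ('a \<Rightarrow> 'a) \<Rightarrow> int \<Rightarrow> 'a \<Rightarrow> bool" where
  "gottlieb_element A V d k v \<longleftrightarrow> v \<in> V \<inter> homog A k \<and>
     (\<exists>\<theta>. derivation_cycle A d k \<theta> \<and> \<theta> v = \<one>\<^bsub>A\<^esub>)"

end

theory Submission
  imports Defs
begin

text \<open>
  Since \<open>x\<close> is odd, \<open>x\<^sup>2 = 0\<close>, so \<open>D = x \<theta>\<close> is a derivation of degree 0 with
  \<open>D a \<cdot> D b = 0\<close> and \<open>D (x a) = x a\<close>. By freeness there is a retraction \<open>\<pi>\<close> of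
  \<open>\<Lambda>V\<close> onto \<open>\<Lambda>W\<close> with \<open>\<pi> x = 0\<close>, and every \<open>a\<close> lies in \<open>\<pi> a + x \<Lambda>V\<close>.
  The map \<open>1 - D \<pi>\<close> is multiplicative because products of values of \<open>D\<close> vanish, and has the
  inverse \<open>1 + D \<pi>\<close> because \<open>\<pi> D = 0\<close>; it agrees with \<open>\<phi>\<close> on \<open>x\<close> and \<open>W\<close>, hence
  everywhere. Conjugation by it gives \<open>\<theta>' = x \<theta>\<^sup>2 = x \<pi> \<theta>\<^sup>2\<close> and
  \<open>d' = - \<theta>' dx + \<pi> (d - dx \<theta>)\<close> on \<open>\<Lambda>W\<close>, where \<open>\<theta>\<^sup>2\<close> and \<open>d - dx \<theta>\<close> are
  derivations. Here \<open>dx \<in> \<Lambda>W\<close> for degree reasons, as \<open>V\<close> starts in degree 2.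
\<close>

section \<open>Graded-commutative algebras\<close>

lemma rat_field_simps [simp]:
  "carrier rat_field = UNIV" "p \<otimes>\<^bsub>rat_field\<^esub> q = p * q" "p \<oplus>\<^bsub>rat_field\<^esub> q = p + q"
  "\<one>\<^bsub>rat_field\<^esub> = 1" "\<zero>\<^bsub>rat_field\<^esub> = 0"
  by (simp_all add: ring_of_type_algebra_def)

lemma powi_minus_one_even: "even k \<Longrightarrow> (-1 :: rat) powi k = 1"
  by (auto simp: power_int_minus_left)

lemma powi_minus_one_odd: "odd k \<Longrightarrow> (-1 :: rat) powi k = -1"
  by (auto simp: power_int_minus_left)

lemma powi_minus_one_parity: "even i = even j \<Longrightarrow> (-1 :: rat) powi i = (-1) powi j"
  by (cases "even i") (simp_all add: powi_minus_one_even powi_minus_one_odd)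

lemma graded_alg_hom_iff:
  "f \<in> graded_alg_hom A B \<longleftrightarrow>
     (\<forall>a\<in>carrier A. f a \<in> carrier B) \<and>
     (\<forall>a\<in>carrier A. \<forall>b\<in>carrier A. f (a \<oplus>\<^bsub>A\<^esub> b) = f a \<oplus>\<^bsub>B\<^esub> f b) \<and>
     (\<forall>a\<in>carrier A. \<forall>b\<in>carrier A. f (a \<otimes>\<^bsub>A\<^esub> b) = f a \<otimes>\<^bsub>B\<^esub> f b) \<and>
     (\<forall>q. \<forall>a\<in>carrier A. f (q \<odot>\<^bsub>A\<^esub> a) = q \<odot>\<^bsub>B\<^esub> f a) \<and>
     f \<one>\<^bsub>A\<^esub> = \<one>\<^bsub>B\<^esub> \<and> (\<forall>k. \<forall>a\<in>homog A k. f a \<in> homog B k)"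
  by (auto simp: graded_alg_hom_def ring_hom_def linear_map_on_def image_subset_iff)

lemma Der_iff:
  "\<theta> \<in> Der A k \<longleftrightarrow>
     (\<forall>a\<in>carrier A. \<theta> a \<in> carrier A) \<and>
     (\<forall>a\<in>carrier A. \<forall>b\<in>carrier A. \<theta> (a \<oplus>\<^bsub>A\<^esub> b) = \<theta> a \<oplus>\<^bsub>A\<^esub> \<theta> b) \<and>
     (\<forall>q. \<forall>a\<in>carrier A. \<theta> (q \<odot>\<^bsub>A\<^esub> a) = q \<odot>\<^bsub>A\<^esub> \<theta> a) \<and>
     (\<forall>i. \<forall>a\<in>homog A i. \<theta> a \<in> homog A (i - k)) \<and>
     (\<forall>i. \<forall>a\<in>homog A i. \<forall>b\<in>carrier A.
        \<theta> (a \<otimes>\<^bsub>A\<^esub> b) = \<theta> a \<otimes>\<^bsub>A\<^esub> b \<oplus>\<^bsub>A\<^esub> ((-1) powi (k * i)) \<odot>\<^bsub>A\<^esub> (a \<otimes>\<^bsub>A\<^esub> \<theta> b))"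
  by (auto simp: Der_def linear_map_on_def image_subset_iff)

locale gc_algebra =
  fixes A :: "'a graded_alg" (structure)
  assumes gca: "graded_commutative_algebra A"

sublocale gc_algebra \<subseteq> ring A
  using gca by (simp add: graded_commutative_algebra_def graded_algebra_def rat_algebra_def)

context gc_algebra
begin

lemma module_A: "module rat_field A"
  using gca by (simp add: graded_commutative_algebra_def graded_algebra_def rat_algebra_def)

lemma smult_closed [simp, intro]: "a \<in> carrier A \<Longrightarrow> q \<odot> a \<in> carrier A"
  using module.smult_closed[OF module_A] by simp

lemma smult_one [simp]: "a \<in> carrier A \<Longrightarrow> 1 \<odot> a = a"
  using module.smult_one[OF module_A] by simp

lemma smult_zero_left [simp]: "a \<in> carrier A \<Longrightarrow> 0 \<odot> a = \<zero>"
  using module.smult_l_null[OF module_A] by simp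

lemma smult_zero_right [simp]: "q \<odot> \<zero> = \<zero>"
  using module.smult_r_null[OF module_A] by simp

lemma smult_add_left: "a \<in> carrier A \<Longrightarrow> (p + q) \<odot> a = p \<odot> a \<oplus> q \<odot> a"
  using module.smult_l_distr[OF module_A, of p q a] by simp

lemma smult_add_right:
  "a \<in> carrier A \<Longrightarrow> b \<in> carrier A \<Longrightarrow> q \<odot> (a \<oplus> b) = q \<odot> a \<oplus> q \<odot> b"
  using module.smult_r_distr[OF module_A, of q a b] by simp

lemma smult_smult: "a \<in> carrier A \<Longrightarrow> p \<odot> (q \<odot> a) = (p * q) \<odot> a"
  using module.smult_assoc1[OF module_A, of p q a] by simp

lemma smult_minus_one [simp]: "a \<in> carrier A \<Longrightarrow> (-1) \<odot> a = \<ominus> a"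
  using smult_add_left[of a "-1" 1] by (simp add: minus_equality)

lemma smult_minus_right: "a \<in> carrier A \<Longrightarrow> q \<odot> (\<ominus> a) = \<ominus> (q \<odot> a)"
  by (metis smult_smult smult_minus_one smult_closed mult.commute)

lemma smult_mult_left:
  "a \<in> carrier A \<Longrightarrow> b \<in> carrier A \<Longrightarrow> (q \<odot> a) \<otimes> b = q \<odot> (a \<otimes> b)"
  using gca by (simp add: graded_commutative_algebra_def graded_algebra_def rat_algebra_def)

lemma smult_mult_right:
  "a \<in> carrier A \<Longrightarrow> b \<in> carrier A \<Longrightarrow> a \<otimes> (q \<odot> b) = q \<odot> (a \<otimes> b)"
  using gca by (simp add: graded_commutative_algebra_def graded_algebra_def rat_algebra_def)

lemma submoduleI:
  assumes "S \<subseteq> carrier A" "\<zero> \<in> S" "\<And>a b. a \<in> S \<Longrightarrow> b \<in> S \<Longrightarrow> a \<oplus> b \<in> S"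
    and smult: "\<And>q a. a \<in> S \<Longrightarrow> q \<odot> a \<in> S"
  shows "submodule S rat_field A"
proof (rule module.submoduleI[OF module_A])
  show "\<ominus> a \<in> S" if "a \<in> S" for a
    using smult[of a "-1"] that assms(1) by auto
qed (use assms in auto)

lemma submoduleD:
  assumes "submodule S rat_field A"
  shows "S \<subseteq> carrier A" "\<zero> \<in> S" "\<And>a b. a \<in> S \<Longrightarrow> b \<in> S \<Longrightarrow> a \<oplus> b \<in> S"
    "\<And>q a. a \<in> S \<Longrightarrow> q \<odot> a \<in> S" "\<And>a. a \<in> S \<Longrightarrow> \<ominus> a \<in> S"
    "\<And>a b. a \<in> S \<Longrightarrow> b \<in> S \<Longrightarrow> a \<ominus> b \<in> S"
proof -
  note E = module.submoduleE[OF module_A assms]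
  show sub: "S \<subseteq> carrier A" by (rule E(1))
  show add: "a \<oplus> b \<in> S" if "a \<in> S" "b \<in> S" for a b using E(5) that .
  show "q \<odot> a \<in> S" if "a \<in> S" for q a using E(4)[of q a] that by simp
  show neg: "\<ominus> a \<in> S" if "a \<in> S" for a using E(3) that .
  obtain a where a: "a \<in> S" using E(2) by blast
  then show "\<zero> \<in> S" using add[OF a neg[OF a]] sub by (simp add: r_neg subset_iff)
  show "a \<ominus> b \<in> S" if "a \<in> S" "b \<in> S" for a b
    using add[OF that(1) neg[OF that(2)]] by (simp add: a_minus_def)
qed

section \<open>Homogeneous components and induction over them\<close>

lemma graded_algebra_A: "graded_algebra A"
  using gca unfolding graded_commutative_algebra_def by (rule conjunct1)

lemma submodule_homog: "submodule (homog A k) rat_field A"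
  using graded_algebra_A by (simp add: graded_algebra_def)

lemmas homog_closed = submoduleD[OF submodule_homog]

lemma homog_carrier [simp, intro]: "a \<in> homog A k \<Longrightarrow> a \<in> carrier A"
  using homog_closed(1) by blast

lemma homog_one: "\<one> \<in> homog A 0"
  using graded_algebra_A by (simp add: graded_algebra_def)

lemma homog_mult: "a \<in> homog A i \<Longrightarrow> b \<in> homog A j \<Longrightarrow> a \<otimes> b \<in> homog A (i + j)"
  using graded_algebra_A by (simp add: graded_algebra_def)

lemma homog_commute:
  "a \<in> homog A i \<Longrightarrow> b \<in> homog A j \<Longrightarrow> a \<otimes> b = ((-1) powi (i * j)) \<odot> (b \<otimes> a)"
  using gca unfolding graded_commutative_algebra_def by blast

lemma ex1_decomp: "a \<in> carrier A \<Longrightarrow> \<exists>!c. homog_decomp A a c"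
  using graded_algebra_A by (simp add: graded_algebra_def)

lemma decomp_unique:
  "homog_decomp A a c \<Longrightarrow> homog_decomp A a c' \<Longrightarrow> c = c'"
proof -
  assume c: "homog_decomp A a c" and c': "homog_decomp A a c'"
  have "(\<Oplus>k\<in>{k. c k \<noteq> \<zero>}. c k) \<in> carrier A"
    using c by (intro finsum_closed) (auto simp: homog_decomp_def)
  then have "a \<in> carrier A" using c by (simp add: homog_decomp_def)
  then show ?thesis using ex1_decomp c c' by blast
qed

text \<open>\<open>homog_decomp\<close> sums over the exact support of \<open>c\<close>, which
  changes when components cancel. Allowing any finite superset makes different sums comparable,
  since the extra terms are zero.\<close>

lemma decomp_finsum:
  assumes "\<And>k. c k \<in> homog A k" "finite F" "{k. c k \<noteq> \<zero>} \<subseteq> F"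
  shows "homog_decomp A (\<Oplus>k\<in>F. c k) c"
proof -
  have fin: "finite {k. c k \<noteq> \<zero>}" using assms(2,3) by (rule finite_subset[rotated])
  have "c k \<in> carrier A" for k using assms(1) by blast
  then have "(\<Oplus>k\<in>F. c k) = (\<Oplus>k\<in>{k. c k \<noteq> \<zero>}. c k)"
    by (intro add.finprod_mono_neutral_cong_right assms) auto
  then show ?thesis
    using assms(1) fin by (simp add: homog_decomp_def)
qed

lemma decomp_zero: "homog_decomp A \<zero> (\<lambda>_. \<zero>)"
  using decomp_finsum[of "\<lambda>_. \<zero>" "{}"] homog_closed(2) by simp

text \<open>Adding \<open>s\<close> can create or cancel the component in degree \<open>k\<close>,
  so both sums run over the support enlarged by \<open>k\<close>, and the \<open>k\<close>-th term
  is split off.\<close>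

lemma decomp_homog_add:
  assumes s: "s \<in> homog A k" and c: "homog_decomp A a c"
  shows "homog_decomp A (s \<oplus> a) (c(k := s \<oplus> c k))"
proof -
  let ?F = "insert k {k. c k \<noteq> \<zero>}"
  have hc: "\<And>j. c j \<in> homog A j" and fin: "finite {k. c k \<noteq> \<zero>}"
    using c by (auto simp: homog_decomp_def)
  have cc: "c j \<in> carrier A" for j using hc by blast
  define c' where "c' = c(k := s \<oplus> c k)"
  have c'k: "c' k = s \<oplus> c k" by (simp add: c'_def)
  have c'c: "c' j \<in> carrier A" for j using s cc by (simp add: c'_def homog_carrier)
  have "homog_decomp A (\<Oplus>j\<in>?F. c j) c" using hc fin by (intro decomp_finsum) auto
  then have "a = (\<Oplus>j\<in>?F. c j)" using c by (simp add: homog_decomp_def)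
  also have "\<dots> = c k \<oplus> (\<Oplus>j\<in>?F - {k}. c j)"
    using fin cc by (subst finsum_insert[symmetric]) (auto simp: insert_absorb)
  finally have "s \<oplus> a = (s \<oplus> c k) \<oplus> (\<Oplus>j\<in>?F - {k}. c j)"
    using s cc by (auto simp: a_assoc intro!: finsum_closed)
  also have "(\<Oplus>j\<in>?F - {k}. c j) = (\<Oplus>j\<in>?F - {k}. c' j)"
    using cc by (intro finsum_cong') (auto simp: c'_def)
  also have "(s \<oplus> c k) \<oplus> \<dots> = (\<Oplus>j\<in>?F. c' j)"
  proof -
    have "finsum A c' (insert k (?F - {k})) = c' k \<oplus> finsum A c' (?F - {k})"
      using fin c'c by (intro finsum_insert) auto
    then show ?thesis by (simp add: c'k)
  qed
  finally have "s \<oplus> a = (\<Oplus>j\<in>?F. c' j)" .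
  moreover have "homog_decomp A (\<Oplus>j\<in>?F. c' j) c'"
    by (rule decomp_finsum) (use fin hc s homog_closed(3) in \<open>auto simp: c'_def\<close>)
  ultimately show ?thesis by (simp add: c'_def)
qed

text \<open>The Leibniz rule and graded commutativity speak of homogeneous factors. This induction,
  one homogeneous summand at a time, carries additive consequences over to arbitrary
  elements.\<close>

lemma homog_induct [consumes 1, case_names zero add]:
  assumes "a \<in> carrier A" and "P \<zero>"
    and "\<And>k s b. s \<in> homog A k \<Longrightarrow> b \<in> carrier A \<Longrightarrow> P b \<Longrightarrow> P (s \<oplus> b)"
  shows "P a"
proof -
  obtain c where c: "homog_decomp A a c" using ex1_decomp[OF assms(1)] by blast
  then have hc: "\<And>j. c j \<in> homog A j" and fin: "finite {k. c k \<noteq> \<zero>}"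
    and a: "a = (\<Oplus>k\<in>{k. c k \<noteq> \<zero>}. c k)"
    by (auto simp: homog_decomp_def)
  have "P (\<Oplus>k\<in>F. c k) \<and> (\<Oplus>k\<in>F. c k) \<in> carrier A" if "finite F" for F
    using that
  proof induction
    case empty
    then show ?case using assms(2) by simp
  next
    case (insert j F)
    have cc: "c j \<in> carrier A" for j using hc by blast
    show ?case
      using insert assms(3)[OF hc[of j]] cc by (auto simp: finsum_insert Pi_def)
  qed
  then show ?thesis using a fin by blast
qed

end

section \<open>Graded subalgebras and generation\<close>

text \<open>The subalgebra is given by its homogeneous pieces, so that closure under products is
  checked on homogeneous elements, where the sign rules apply.\<close>

locale graded_subalgebra = gc_algebra +
  fixes S :: "int \<Rightarrow> 'a set"
  assumes sub_homog: "S k \<subseteq> homog A k"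
    and sub_submodule: "submodule (S k) rat_field A"
    and sub_one: "\<one> \<in> S 0"
    and sub_mult: "a \<in> S i \<Longrightarrow> b \<in> S j \<Longrightarrow> a \<otimes> b \<in> S (i + j)"
begin

text \<open>The sum of the pieces, as an inductive set, so that closure properties follow by rule
  induction instead of manipulations of \<open>finsum\<close>.\<close>

inductive_set total :: "'a set" where
  zero: "\<zero> \<in> total"
| add: "s \<in> S k \<Longrightarrow> a \<in> total \<Longrightarrow> s \<oplus> a \<in> total"

definition subalg :: "'a graded_alg" where
  "subalg = A\<lparr>carrier := total, homog := S\<rparr>"

lemmas sub_closed = submoduleD[OF sub_submodule]

lemma S_carrier: "s \<in> S k \<Longrightarrow> s \<in> carrier A"
  using sub_closed(1) by blast

lemma total_carrier: "a \<in> total \<Longrightarrow> a \<in> carrier A"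
  by (induction rule: total.induct) (auto intro: S_carrier)

lemma S_total: "s \<in> S k \<Longrightarrow> s \<in> total"
  using total.add[OF _ total.zero, of s k] S_carrier[of s k] by simp

lemma total_add: "a \<in> total \<Longrightarrow> b \<in> total \<Longrightarrow> a \<oplus> b \<in> total"
  by (induction rule: total.induct)
    (auto intro: total.add simp: a_assoc S_carrier total_carrier)

lemma total_smult: "a \<in> total \<Longrightarrow> q \<odot> a \<in> total"
  by (induction rule: total.induct)
    (auto intro: total.intros sub_closed(4) simp: smult_add_right S_carrier total_carrier)

lemma total_minus: "a \<in> total \<Longrightarrow> \<ominus> a \<in> total"
  using total_smult[of a "-1"] total_carrier[of a] by simp

lemma total_mult_homog: "b \<in> total \<Longrightarrow> s \<in> S i \<Longrightarrow> s \<otimes> b \<in> total"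
  by (induction rule: total.induct)
    (auto intro: total.intros sub_mult simp: r_distr S_carrier total_carrier)

lemma total_mult: "a \<in> total \<Longrightarrow> b \<in> total \<Longrightarrow> a \<otimes> b \<in> total"
  by (induction rule: total.induct)
    (auto intro: total.zero total_add total_mult_homog simp: l_distr S_carrier total_carrier)

text \<open>Adding summands one by one with \<open>decomp_homog_add\<close> keeps every component
  inside its piece. As decompositions in \<open>A\<close> are unique, this yields the grading of
  \<open>subalg\<close>.\<close>

lemma total_decomp: "a \<in> total \<Longrightarrow> \<exists>c. homog_decomp A a c \<and> (\<forall>k. c k \<in> S k)"
proof (induction rule: total.induct)
  case zero
  then show ?case using decomp_zero sub_closed(2) by blast
next
  case (add s k a)
  then obtain c where c: "homog_decomp A a c" "\<And>k. c k \<in> S k" by blast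
  have "homog_decomp A (s \<oplus> a) (c(k := s \<oplus> c k))"
    using decomp_homog_add[OF _ c(1)] add(1) sub_homog by blast
  moreover have "\<forall>j. (c(k := s \<oplus> c k)) j \<in> S j"
    using c(2) add(1) sub_closed(3) by auto
  ultimately show ?case by blast
qed

lemma subalg_simps [simp]:
  "carrier subalg = total" "homog subalg = S" "monoid.mult subalg = monoid.mult A" "monoid.one subalg = monoid.one A"
  "ring.zero subalg = ring.zero A" "ring.add subalg = ring.add A" "module.smult subalg = module.smult A"
  by (simp_all add: subalg_def)

lemma abelian_group_subalg: "abelian_group subalg"
proof (rule abelian_groupI)
  show "\<exists>b\<in>carrier subalg. b \<oplus>\<^bsub>subalg\<^esub> a = \<zero>\<^bsub>subalg\<^esub>" if "a \<in> carrier subalg" for a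
    using that by (intro bexI[of _ "\<ominus> a"]) (auto simp: total_minus total_carrier l_neg)
qed (auto simp: total_carrier total.zero total_add a_ac)

lemma ring_subalg: "ring subalg"
proof (rule ringI[OF abelian_group_subalg])
  show "monoid subalg"
    by (rule monoidI)
      (auto simp: total_carrier total_mult m_assoc intro: S_total[OF sub_one])
qed (auto simp: total_carrier l_distr r_distr)

lemma module_subalg: "module rat_field subalg"
proof (rule moduleI[OF _ abelian_group_subalg])
  show "cring rat_field" by (rule cring_from_type_algebra)
qed (auto simp: total_carrier total_smult smult_add_left smult_add_right smult_smult)

text \<open>\<open>finsum\<close> depends on the whole structure, so the agreement of the additions
  is transferred by induction on the index set.\<close>

lemma finsum_subalg:
  "finite F \<Longrightarrow> (\<And>k. c k \<in> total) \<Longrightarrow> finsum subalg c F = finsum A c F"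
proof (induction rule: finite_induct)
  case empty
  show ?case
    using abelian_monoid.finsum_empty[OF abelian_group.axioms(1)[OF abelian_group_subalg]] by simp
next
  case (insert k F)
  then show ?case
    using abelian_monoid.finsum_insert[OF abelian_group.axioms(1)[OF abelian_group_subalg], of F k c]
    by (simp add: finsum_insert Pi_def total_carrier)
qed

lemma decomp_subalg: "homog_decomp subalg a c \<longleftrightarrow> homog_decomp A a c \<and> (\<forall>k. c k \<in> S k)"
proof (cases "(\<forall>k. c k \<in> S k) \<and> finite {k. c k \<noteq> \<zero>}")
  case True
  then have "finsum subalg c {k. c k \<noteq> \<zero>} = finsum A c {k. c k \<noteq> \<zero>}"
    by (intro finsum_subalg) (auto intro: S_total)
  moreover have "c k \<in> homog A k" for k using True sub_homog by blast
  ultimately show ?thesis using True by (simp add: homog_decomp_def)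
next
  case False
  then show ?thesis by (auto simp: homog_decomp_def)
qed

text \<open>This makes \<open>subalg\<close> an admissible target in the universal property of
  \<open>free_on\<close>, as its elements have the same type as those of \<open>A\<close>.\<close>

lemma gca_subalg: "graded_commutative_algebra subalg"
  unfolding graded_commutative_algebra_def graded_algebra_def rat_algebra_def
proof (intro conjI allI ballI)
  show "\<exists>!c. homog_decomp subalg a c" if a: "a \<in> carrier subalg" for a
  proof -
    obtain c where "homog_decomp A a c" "\<forall>k. c k \<in> S k"
      using total_decomp[of a] a by auto
    then show ?thesis
      by (intro ex1I[of _ c]) (auto simp: decomp_subalg intro: decomp_unique)
  qed
  show "submodule (homog subalg k) rat_field subalg" for k
  proof (rule module.submoduleI[OF module_subalg])
    show "\<ominus>\<^bsub>subalg\<^esub> a \<in> homog subalg k" if "a \<in> homog subalg k" for a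
    proof -
      have a: "a \<in> S k" "a \<in> carrier A" "\<ominus> a \<in> total" "a \<in> total"
        using that by (auto intro: S_carrier total_minus S_total)
      \<comment> \<open>Negation is defined relative to the structure; uniqueness of additive
        inverses in \<open>subalg\<close> identifies it with negation in \<open>A\<close>.\<close>
      then have "\<ominus>\<^bsub>subalg\<^esub> a = \<ominus> a"
        by (intro abelian_group.minus_equality[OF abelian_group_subalg]) (auto simp: l_neg)
      then show ?thesis using a sub_closed(5) by simp
    qed
  qed (use sub_closed S_total in auto)
  show "a \<otimes>\<^bsub>subalg\<^esub> b = (-1) powi (i * j) \<odot>\<^bsub>subalg\<^esub> (b \<otimes>\<^bsub>subalg\<^esub> a)"
    if "a \<in> homog subalg i" "b \<in> homog subalg j" for a b i j
  proof -
    have "a \<in> homog A i" "b \<in> homog A j" using that sub_homog by auto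
    then show ?thesis unfolding subalg_simps by (rule homog_commute)
  qed
qed (use ring_subalg module_subalg sub_one sub_mult
      in \<open>auto simp: total_carrier smult_mult_left smult_mult_right\<close>)

end

section \<open>The universal property and generation by \<open>V\<close>\<close>

locale free_algebra = gc_algebra +
  fixes V :: "'a set"
  assumes free: "free_on A V"
begin

lemma V_submodule: "submodule V rat_field A"
  using free by (simp add: free_on_def graded_subspace_def)

lemma V_decomp: "v \<in> V \<Longrightarrow> homog_decomp A v c \<Longrightarrow> c k \<in> V"
  using free by (simp add: free_on_def graded_subspace_def)

lemma V_carrier: "v \<in> V \<Longrightarrow> v \<in> carrier A"
  using submoduleD(1)[OF V_submodule] by blast

lemma ex1_extension:
  fixes B :: "'a graded_alg"
  assumes "graded_commutative_algebra B" "linear_map_on A V B f"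
    "\<And>k v. v \<in> V \<Longrightarrow> v \<in> homog A k \<Longrightarrow> f v \<in> homog B k"
  shows "\<exists>!g. g \<in> extensional (carrier A) \<and> g \<in> graded_alg_hom A B \<and> (\<forall>v \<in> V. g v = f v)"
proof -
  have "\<forall>k. f ` (V \<inter> homog A k) \<subseteq> homog B k" using assms(3) by auto
  then show ?thesis
    using free assms(1,2) unfolding free_on_def by blast
qed

lemma hom_linear: "f \<in> graded_alg_hom A B \<Longrightarrow> linear_map_on A (carrier A) B f"
  by (simp add: graded_alg_hom_def)

lemma hom_restrict:
  "f \<in> graded_alg_hom A A \<Longrightarrow> restrict f (carrier A) \<in> graded_alg_hom A A"
  by (auto simp: graded_alg_hom_iff)

text \<open>Restricted to the carrier, both maps extend the same degree-preserving linear map on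
  \<open>V\<close>. The restriction makes the uniqueness clause, stated for
  \<open>extensional\<close> maps, applicable.\<close>

lemma hom_eqI:
  assumes "f \<in> graded_alg_hom A A" "g \<in> graded_alg_hom A A" "\<And>v. v \<in> V \<Longrightarrow> f v = g v"
    and "a \<in> carrier A"
  shows "f a = g a"
proof -
  have "linear_map_on A V A f"
    using hom_linear[OF assms(1)] V_carrier unfolding linear_map_on_def by (auto simp: Pi_def)
  moreover have "\<And>k v. v \<in> homog A k \<Longrightarrow> f v \<in> homog A k"
    using assms(1) by (auto simp: graded_alg_hom_def)
  ultimately have "\<exists>!g. g \<in> extensional (carrier A) \<and> g \<in> graded_alg_hom A A \<and> (\<forall>v \<in> V. g v = f v)"
    by (intro ex1_extension gca) auto
  then have "restrict f (carrier A) = restrict g (carrier A)"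
    using hom_restrict[OF assms(1)] hom_restrict[OF assms(2)] assms(3) V_carrier
    by (metis restrict_apply restrict_extensional)
  then show ?thesis using assms(4) by (metis restrict_apply)
qed

text \<open>
  \<open>V\<close> generates \<open>A\<close>, in the form of an induction principle: composing the extension
  \<open>A \<rightarrow> subalg\<close> of the inclusion of \<open>V\<close> with \<open>subalg \<rightarrow> A\<close> gives the identity by uniqueness.
\<close>

lemma homog_subset_subalgebra:
  assumes "graded_subalgebra A S" and "\<And>k. V \<inter> homog A k \<subseteq> S k"
  shows "homog A k \<subseteq> S k"
proof -
  interpret S: graded_subalgebra A S by (rule assms(1))
  \<comment> \<open>\<open>V\<close> is graded, so the components of \<open>v\<close> lie in
    \<open>V\<close> and hence in the pieces \<open>S k\<close>.\<close>
  have V_total: "v \<in> S.total" if v: "v \<in> V" for v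
  proof -
    obtain c where c: "homog_decomp A v c" using ex1_decomp[OF V_carrier[OF v]] by blast
    have cS: "c k \<in> S k" for k
      using V_decomp[OF v c] assms(2) c by (auto simp: homog_decomp_def)
    have "(\<Oplus>k\<in>F. c k) \<in> S.total" if "finite F" for F
      using that
    proof (induction rule: finite_induct)
      case empty
      then show ?case by (simp add: S.total.zero)
    next
      case (insert k F)
      have "c k \<in> carrier A" for k using S.S_carrier cS by blast
      then show ?case using insert S.total.add[OF cS] by (simp add: finsum_insert)
    qed
    then show ?thesis using c by (auto simp: homog_decomp_def)
  qed
  have "linear_map_on A V S.subalg (\<lambda>v. v)"
    using V_total by (simp add: linear_map_on_def)
  moreover have "v \<in> homog S.subalg k" if "v \<in> V" "v \<in> homog A k" for v k
    using assms(2) that by auto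
  ultimately obtain g where g: "g \<in> graded_alg_hom A S.subalg" "\<forall>v\<in>V. g v = v"
    using ex1_extension[OF S.gca_subalg] by blast
  have "g \<in> graded_alg_hom A A"
    using g(1) S.total_carrier S.sub_homog
    by (simp add: graded_alg_hom_iff subset_iff)
  moreover have "(\<lambda>a. a) \<in> graded_alg_hom A A"
    by (simp add: graded_alg_hom_iff)
  ultimately have "g a = a" if "a \<in> carrier A" for a
    using hom_eqI[of g "\<lambda>a. a"] g(2) that by blast
  moreover have "g ` homog A k \<subseteq> S k" using g(1) by (auto simp: graded_alg_hom_iff)
  ultimately show ?thesis by force
qed

end

section \<open>Derivations\<close>

context gc_algebra
begin

lemma Der_closed: "\<theta> \<in> Der A k \<Longrightarrow> a \<in> carrier A \<Longrightarrow> \<theta> a \<in> carrier A"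
  by (simp add: Der_iff)

lemma Der_add:
  "\<theta> \<in> Der A k \<Longrightarrow> a \<in> carrier A \<Longrightarrow> b \<in> carrier A \<Longrightarrow> \<theta> (a \<oplus> b) = \<theta> a \<oplus> \<theta> b"
  by (simp add: Der_iff)

lemma Der_smult: "\<theta> \<in> Der A k \<Longrightarrow> a \<in> carrier A \<Longrightarrow> \<theta> (q \<odot> a) = q \<odot> \<theta> a"
  by (simp add: Der_iff)

lemma Der_minus: "\<theta> \<in> Der A k \<Longrightarrow> a \<in> carrier A \<Longrightarrow> \<theta> (\<ominus> a) = \<ominus> \<theta> a"
  using Der_smult[of \<theta> k a "-1"] by (simp add: Der_closed)

lemma Der_diff:
  "\<theta> \<in> Der A k \<Longrightarrow> a \<in> carrier A \<Longrightarrow> b \<in> carrier A \<Longrightarrow> \<theta> (a \<ominus> b) = \<theta> a \<ominus> \<theta> b"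
  by (simp add: a_minus_def Der_add Der_minus)

lemma Der_homog: "\<theta> \<in> Der A k \<Longrightarrow> a \<in> homog A i \<Longrightarrow> \<theta> a \<in> homog A (i - k)"
  by (simp add: Der_iff)

lemma Der_mult:
  "\<theta> \<in> Der A k \<Longrightarrow> a \<in> homog A i \<Longrightarrow> b \<in> carrier A \<Longrightarrow>
    \<theta> (a \<otimes> b) = \<theta> a \<otimes> b \<oplus> ((-1) powi (k * i)) \<odot> (a \<otimes> \<theta> b)"
  unfolding Der_iff by blast

lemma Der_one: "\<theta> \<in> Der A k \<Longrightarrow> \<theta> \<one> = \<zero>"
  using Der_mult[of \<theta> k \<one> 0 \<one>] homog_one Der_closed[of \<theta> k \<one>]
  by (simp add: add.r_cancel_one')

text \<open>In degree 0 all signs are 1, so the rule is additive in \<open>a\<close> and extends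
  from homogeneous \<open>a\<close> to the whole carrier.\<close>

lemma Der_zero_mult:
  assumes "\<theta> \<in> Der A 0" "a \<in> carrier A" "b \<in> carrier A"
  shows "\<theta> (a \<otimes> b) = \<theta> a \<otimes> b \<oplus> a \<otimes> \<theta> b"
  using assms(2)
proof (induction rule: homog_induct)
  case zero
  have "\<theta> \<zero> = \<zero>" using Der_smult[OF assms(1), of \<zero> 0] Der_closed[OF assms(1), of \<zero>] by simp
  then show ?case using assms Der_closed by simp
next
  case (add k s c)
  have s: "s \<in> carrier A" using add(1) by (rule homog_carrier)
  have "\<theta> (s \<otimes> b) = \<theta> s \<otimes> b \<oplus> s \<otimes> \<theta> b"
    using Der_mult[OF assms(1) add(1) assms(3)] s assms Der_closed by simp
  then show ?case
    using add s assms
    by (simp add: l_distr Der_add[OF assms(1)] Der_closed[OF assms(1)] a_ac)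
qed

lemma Der_diff_closed:
  assumes \<theta>: "\<theta> \<in> Der A k" and \<eta>: "\<eta> \<in> Der A k"
  shows "(\<lambda>a. \<theta> a \<ominus> \<eta> a) \<in> Der A k"
  unfolding Der_iff
proof (intro conjI allI ballI)
  fix a b assume a: "a \<in> carrier A" and b: "b \<in> carrier A"
  show "\<theta> (a \<oplus> b) \<ominus> \<eta> (a \<oplus> b) = (\<theta> a \<ominus> \<eta> a) \<oplus> (\<theta> b \<ominus> \<eta> b)"
    using a b Der_closed[OF \<theta>] Der_closed[OF \<eta>]
    by (simp add: Der_add[OF \<theta>] Der_add[OF \<eta>] a_minus_def minus_add a_ac)
next
  fix q a assume a: "a \<in> carrier A"
  show "\<theta> (q \<odot> a) \<ominus> \<eta> (q \<odot> a) = q \<odot> (\<theta> a \<ominus> \<eta> a)"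
    using a Der_closed[OF \<theta>] Der_closed[OF \<eta>]
    by (simp add: Der_smult[OF \<theta>] Der_smult[OF \<eta>] a_minus_def smult_add_right smult_minus_right)
next
  fix i a assume "a \<in> homog A i"
  then show "\<theta> a \<ominus> \<eta> a \<in> homog A (i - k)"
    by (intro homog_closed(6) Der_homog \<theta> \<eta>)
next
  fix i a b assume a: "a \<in> homog A i" and b: "b \<in> carrier A"
  note cl = Der_closed[OF \<theta>] Der_closed[OF \<eta>] homog_carrier[OF a] b
  show "\<theta> (a \<otimes> b) \<ominus> \<eta> (a \<otimes> b) =
      (\<theta> a \<ominus> \<eta> a) \<otimes> b \<oplus> (-1) powi (k * i) \<odot> (a \<otimes> (\<theta> b \<ominus> \<eta> b))"
    unfolding Der_mult[OF \<theta> a b] Der_mult[OF \<eta> a b] using cl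
    by (simp add: a_minus_def l_distr r_distr l_minus r_minus minus_add smult_add_right
        smult_minus_right a_ac)
qed (use Der_closed[OF \<theta>] Der_closed[OF \<eta>] in simp)

text \<open>Multiplication by \<open>y\<close> raises degrees by \<open>j\<close>, whence the degree
  \<open>k - j\<close>. Moving \<open>y\<close> past \<open>a\<close> costs the sign with exponent
  \<open>j * i\<close>; it fits because \<open>k + j\<close> and \<open>k - j\<close> have the same
  parity.\<close>

lemma Der_left_mult:
  assumes y: "y \<in> homog A j" and \<theta>: "\<theta> \<in> Der A k"
  shows "(\<lambda>a. y \<otimes> \<theta> a) \<in> Der A (k - j)"
  unfolding Der_iff
proof (intro conjI allI ballI)
  fix i a assume "a \<in> homog A i"
  then have "y \<otimes> \<theta> a \<in> homog A (j + (i - k))"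
    by (intro homog_mult[OF y] Der_homog[OF \<theta>])
  then show "y \<otimes> \<theta> a \<in> homog A (i - (k - j))" by (simp add: algebra_simps)
next
  fix i a b assume a: "a \<in> homog A i" and b: "b \<in> carrier A"
  note cl = Der_closed[OF \<theta>] homog_carrier[OF a] b homog_carrier[OF y]
  have ya: "y \<otimes> a = (-1) powi (j * i) \<odot> (a \<otimes> y)" using y a by (rule homog_commute)
  have "y \<otimes> \<theta> (a \<otimes> b) = y \<otimes> \<theta> a \<otimes> b \<oplus> (-1) powi (k * i) \<odot> (y \<otimes> a \<otimes> \<theta> b)"
    unfolding Der_mult[OF \<theta> a b] using cl by (simp add: r_distr m_assoc smult_mult_right)
  also have "(-1) powi (k * i) \<odot> (y \<otimes> a \<otimes> \<theta> b) =
      ((-1) powi (k * i) * (-1) powi (j * i)) \<odot> (a \<otimes> (y \<otimes> \<theta> b))"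
    unfolding ya using cl by (simp add: smult_mult_left smult_smult m_assoc)
  also have "(-1 :: rat) powi (k * i) * (-1) powi (j * i) = (-1) powi ((k - j) * i)"
    by (subst power_int_add[symmetric]) (auto intro: powi_minus_one_parity)
  finally show "y \<otimes> \<theta> (a \<otimes> b) =
      y \<otimes> \<theta> a \<otimes> b \<oplus> (-1) powi ((k - j) * i) \<odot> (a \<otimes> (y \<otimes> \<theta> b))" .
qed (use homog_carrier[OF y] Der_closed[OF \<theta>]
    in \<open>simp_all add: Der_add[OF \<theta>] Der_smult[OF \<theta>] r_distr smult_mult_right\<close>)

text \<open>The products of \<theta> a and \<theta> b occur with the signs of exponents
  \<open>k * i\<close> and \<open>k * (i - k)\<close>. These are opposite for odd \<open>k\<close>,
  so the cross terms cancel.\<close>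

lemma Der_square:
  assumes \<theta>: "\<theta> \<in> Der A k" and k: "odd k"
  shows "(\<lambda>a. \<theta> (\<theta> a)) \<in> Der A (2 * k)"
  unfolding Der_iff
proof (intro conjI allI ballI)
  fix i a assume a: "a \<in> homog A i"
  show "\<theta> (\<theta> a) \<in> homog A (i - 2 * k)"
    using Der_homog[OF \<theta> Der_homog[OF \<theta> a]] by (simp add: algebra_simps)
next
  fix i a b assume a: "a \<in> homog A i" and b: "b \<in> carrier A"
  note cl = Der_closed[OF \<theta>] homog_carrier[OF a] b
  define s where "s = (-1 :: rat) powi (k * i)"
  have ss: "s * s = 1" unfolding s_def
    by (subst power_int_add[symmetric]) (auto intro: powi_minus_one_even)
  have s': "(-1 :: rat) powi (k * (i - k)) = - s"
    using k by (cases "even i") (simp_all add: s_def powi_minus_one_even powi_minus_one_odd)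
  have s'': "(-1 :: rat) powi (2 * k * i) = 1" by (simp add: powi_minus_one_even)
  have "\<theta> (\<theta> (a \<otimes> b)) = \<theta> (\<theta> a \<otimes> b) \<oplus> s \<odot> \<theta> (a \<otimes> \<theta> b)"
    unfolding Der_mult[OF \<theta> a b] s_def[symmetric] using cl
    by (simp add: Der_add[OF \<theta>] Der_smult[OF \<theta>])
  also have "\<theta> (\<theta> a \<otimes> b) = \<theta> (\<theta> a) \<otimes> b \<oplus> (- s) \<odot> (\<theta> a \<otimes> \<theta> b)"
    using Der_mult[OF \<theta> Der_homog[OF \<theta> a] b] by (simp add: s')
  also have "\<theta> (a \<otimes> \<theta> b) = \<theta> a \<otimes> \<theta> b \<oplus> s \<odot> (a \<otimes> \<theta> (\<theta> b))"
    using Der_mult[OF \<theta> a] cl by (simp add: s_def)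
  also have "s \<odot> (\<theta> a \<otimes> \<theta> b \<oplus> s \<odot> (a \<otimes> \<theta> (\<theta> b))) =
      s \<odot> (\<theta> a \<otimes> \<theta> b) \<oplus> a \<otimes> \<theta> (\<theta> b)"
    using cl by (simp add: smult_add_right smult_smult ss)
  also have "\<theta> (\<theta> a) \<otimes> b \<oplus> (- s) \<odot> (\<theta> a \<otimes> \<theta> b) \<oplus> (s \<odot> (\<theta> a \<otimes> \<theta> b) \<oplus> a \<otimes> \<theta> (\<theta> b)) =
      \<theta> (\<theta> a) \<otimes> b \<oplus> (((- s) \<odot> (\<theta> a \<otimes> \<theta> b) \<oplus> s \<odot> (\<theta> a \<otimes> \<theta> b)) \<oplus> a \<otimes> \<theta> (\<theta> b))"
    using cl by (simp add: a_assoc)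
  also have "(- s) \<odot> (\<theta> a \<otimes> \<theta> b) \<oplus> s \<odot> (\<theta> a \<otimes> \<theta> b) = \<zero>"
    using cl by (simp add: smult_add_left[symmetric])
  finally show "\<theta> (\<theta> (a \<otimes> b)) =
      \<theta> (\<theta> a) \<otimes> b \<oplus> (-1) powi (2 * k * i) \<odot> (a \<otimes> \<theta> (\<theta> b))"
    using cl by (simp add: s'')
qed (use Der_closed[OF \<theta>] in \<open>simp_all add: Der_add[OF \<theta>] Der_smult[OF \<theta>]\<close>)

text \<open>Graded commutativity makes the square equal to its own negative, and 2 is invertible in
  the rationals.\<close>

lemma odd_square_zero:
  assumes x: "x \<in> homog A k" and k: "odd k"
  shows "x \<otimes> x = \<zero>"
proof -
  have xc: "x \<otimes> x \<in> carrier A" using homog_carrier[OF x] by simp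
  have "\<ominus> (x \<otimes> x) = x \<otimes> x"
    using homog_commute[OF x x] k xc by (simp add: powi_minus_one_odd)
  then have "x \<otimes> x \<oplus> x \<otimes> x = \<zero>"
    using r_neg[OF xc] by simp
  then have "2 \<odot> (x \<otimes> x) = \<zero>"
    using smult_add_left[OF xc, of 1 1] xc by simp
  then have "(1 / 2 * 2) \<odot> (x \<otimes> x) = \<zero>"
    using smult_smult[OF xc, of "1/2" 2] by simp
  then show ?thesis using xc by simp
qed

text \<open>Each homogeneous summand of \<open>a\<close> can be exchanged with the second
  \<open>x\<close> up to sign, which brings the two copies of \<open>x\<close> together.\<close>

lemma odd_mid_zero:
  assumes x: "x \<in> homog A k" and k: "odd k" and a: "a \<in> carrier A"
  shows "x \<otimes> (a \<otimes> x) = \<zero>"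
  using a
proof (induction rule: homog_induct)
  case zero
  then show ?case using homog_carrier[OF x] by simp
next
  case (add j s b)
  have c: "x \<in> carrier A" "s \<in> carrier A" using x add(1) by auto
  have "x \<otimes> (s \<otimes> x) = (-1) powi (j * k) \<odot> (x \<otimes> x \<otimes> s)"
    unfolding homog_commute[OF add(1) x] using c by (simp add: smult_mult_right m_assoc)
  also have "\<dots> = \<zero>" using c by (simp add: odd_square_zero[OF x k])
  finally show ?case using add c by (simp add: l_distr r_distr)
qed

section \<open>Graded endomorphisms\<close>

lemma hom_closed: "f \<in> graded_alg_hom A A \<Longrightarrow> a \<in> carrier A \<Longrightarrow> f a \<in> carrier A"
  by (simp add: graded_alg_hom_iff)

lemma hom_add:
  "f \<in> graded_alg_hom A A \<Longrightarrow> a \<in> carrier A \<Longrightarrow> b \<in> carrier A \<Longrightarrow> f (a \<oplus> b) = f a \<oplus> f b"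
  by (simp add: graded_alg_hom_iff)

lemma hom_mult:
  "f \<in> graded_alg_hom A A \<Longrightarrow> a \<in> carrier A \<Longrightarrow> b \<in> carrier A \<Longrightarrow> f (a \<otimes> b) = f a \<otimes> f b"
  by (simp add: graded_alg_hom_iff)

lemma hom_smult: "f \<in> graded_alg_hom A A \<Longrightarrow> a \<in> carrier A \<Longrightarrow> f (q \<odot> a) = q \<odot> f a"
  by (simp add: graded_alg_hom_iff)

lemma hom_one: "f \<in> graded_alg_hom A A \<Longrightarrow> f \<one> = \<one>"
  by (simp add: graded_alg_hom_iff)

lemma hom_homog: "f \<in> graded_alg_hom A A \<Longrightarrow> a \<in> homog A k \<Longrightarrow> f a \<in> homog A k"
  by (simp add: graded_alg_hom_iff)

lemma hom_zero: "f \<in> graded_alg_hom A A \<Longrightarrow> f \<zero> = \<zero>"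
  using hom_smult[of f \<zero> 0] by (simp add: hom_closed)

lemma hom_minus: "f \<in> graded_alg_hom A A \<Longrightarrow> a \<in> carrier A \<Longrightarrow> f (\<ominus> a) = \<ominus> f a"
  using hom_smult[of f a "-1"] by (simp add: hom_closed)

lemma hom_diff:
  "f \<in> graded_alg_hom A A \<Longrightarrow> a \<in> carrier A \<Longrightarrow> b \<in> carrier A \<Longrightarrow> f (a \<ominus> b) = f a \<ominus> f b"
  by (simp add: a_minus_def hom_add hom_minus)

section \<open>Spans and generated subalgebras\<close>

lemma vspan_singleton:
  assumes x: "x \<in> carrier A"
  shows "vspan A {x} = range (\<lambda>q. q \<odot> x)"
  unfolding vspan_def
proof (rule hull_unique)
  show "{x} \<subseteq> range (\<lambda>q. q \<odot> x)" using smult_one[OF x] by (auto intro: rev_image_eqI[of 1])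
  show "submodule (range (\<lambda>q. q \<odot> x)) rat_field A"
  proof (rule submoduleI)
    show "\<zero> \<in> range (\<lambda>q. q \<odot> x)" using smult_zero_left[OF x] by (metis rangeI)
  qed (use x in \<open>auto simp: smult_smult smult_add_left[symmetric]\<close>)
  show "range (\<lambda>q. q \<odot> x) \<subseteq> S" if "{x} \<subseteq> S" "submodule S rat_field A" for S
    using that submoduleD(4)[of S] by auto
qed

lemma gen_subalg_simps [simp]:
  "monoid.mult (gen_subalg A W) = monoid.mult A" "ring.add (gen_subalg A W) = ring.add A"
  "module.smult (gen_subalg A W) = module.smult A"
  "homog (gen_subalg A W) k = homog A k \<inter> carrier (gen_subalg A W)"
  by (simp_all add: gen_subalg_def Let_def)

lemma carrier_gen_subalg:
  "carrier (gen_subalg A W) = (\<lambda>H. subring H A \<and> submodule H rat_field A) hull W"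
  by (simp add: gen_subalg_def Let_def)

lemma gen_subalg_minimal:
  "W \<subseteq> H \<Longrightarrow> subring H A \<Longrightarrow> submodule H rat_field A \<Longrightarrow> carrier (gen_subalg A W) \<subseteq> H"
  unfolding carrier_gen_subalg by (rule hull_minimal) auto

lemma gen_subalg_subset: "W \<subseteq> carrier A \<Longrightarrow> carrier (gen_subalg A W) \<subseteq> carrier A"
  by (intro gen_subalg_minimal carrier_is_subring module.carrier_is_submodule module_A)

lemma gen_subalg_closed:
  shows "W \<subseteq> carrier (gen_subalg A W)" "\<zero> \<in> carrier (gen_subalg A W)"
    "\<one> \<in> carrier (gen_subalg A W)"
    "a \<in> carrier (gen_subalg A W) \<Longrightarrow> q \<odot> a \<in> carrier (gen_subalg A W)"
    "a \<in> carrier (gen_subalg A W) \<Longrightarrow> b \<in> carrier (gen_subalg A W) \<Longrightarrow>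
      a \<oplus> b \<in> carrier (gen_subalg A W)"
    "a \<in> carrier (gen_subalg A W) \<Longrightarrow> b \<in> carrier (gen_subalg A W) \<Longrightarrow>
      a \<otimes> b \<in> carrier (gen_subalg A W)"
  using subringE(2,3,6,7)[of _ A] submoduleD(4)
  unfolding carrier_gen_subalg hull_def by auto

text \<open>Combined with \<open>gen_subalg_minimal\<close>, this shows that an endomorphism fixing
  \<open>W\<close> pointwise fixes all of \<open>gen_subalg A W\<close>.\<close>

lemma hom_fixed_points:
  assumes "f \<in> graded_alg_hom A A"
  shows "subring {a \<in> carrier A. f a = a} A" "submodule {a \<in> carrier A. f a = a} rat_field A"
  using assms
  by (auto intro!: subringI submoduleI
      simp: hom_add hom_mult hom_one hom_zero hom_minus hom_smult)

text \<open>Here \<open>f\<close> is a retraction onto \<Lambda>W. It is multiplicative and fixes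
  \<Lambda>W pointwise, so applying it to the Leibniz rule for two elements of \<Lambda>W changes
  only the values of \<theta>.\<close>

lemma Der_retract:
  assumes f: "f \<in> graded_alg_hom A A" and W: "W \<subseteq> carrier A"
    and fW: "\<And>w. w \<in> W \<Longrightarrow> f w = w"
    and im: "\<And>a. a \<in> carrier A \<Longrightarrow> f a \<in> carrier (gen_subalg A W)"
    and \<theta>: "\<theta> \<in> Der A k"
  shows "(\<lambda>a. f (\<theta> a)) \<in> Der (gen_subalg A W) k"
proof -
  note cl = gen_subalg_subset[OF W, THEN subsetD]
  have eq: "f a = a" if "a \<in> carrier (gen_subalg A W)" for a
    using gen_subalg_minimal[of W "{a \<in> carrier A. f a = a}"] hom_fixed_points[OF f] W fW that by blast
  show ?thesis
    unfolding Der_iff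
  proof (intro conjI allI ballI)
    fix i a b assume "a \<in> homog (gen_subalg A W) i" and b: "b \<in> carrier (gen_subalg A W)"
    then have a: "a \<in> homog A i" and a': "a \<in> carrier (gen_subalg A W)" by auto
    show "f (\<theta> (a \<otimes>\<^bsub>gen_subalg A W\<^esub> b)) = f (\<theta> a) \<otimes>\<^bsub>gen_subalg A W\<^esub> b \<oplus>\<^bsub>gen_subalg A W\<^esub>
        (-1) powi (k * i) \<odot>\<^bsub>gen_subalg A W\<^esub> (a \<otimes>\<^bsub>gen_subalg A W\<^esub> f (\<theta> b))"
      unfolding gen_subalg_simps Der_mult[OF \<theta> a cl[OF b]]
      using f cl[OF a'] cl[OF b] Der_closed[OF \<theta>] eq[OF a'] eq[OF b]
      by (simp add: hom_add hom_mult hom_smult)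
  next
    fix i a assume "a \<in> homog (gen_subalg A W) i"
    then have a: "a \<in> homog A i" by simp
    then show "f (\<theta> a) \<in> homog (gen_subalg A W) (i - k)"
      using hom_homog[OF f Der_homog[OF \<theta> a]] im[OF Der_closed[OF \<theta> homog_carrier[OF a]]] by simp
  qed (use f cl Der_closed[OF \<theta>] im in
      \<open>simp_all add: Der_add[OF \<theta>] Der_smult[OF \<theta>] hom_add hom_smult\<close>)
qed

end

section \<open>Splitting off an odd generator\<close>

locale split_generator = free_algebra +
  fixes x :: 'a and k :: int and W :: "'a set"
  assumes x_homog: "x \<in> homog A k" and k_odd: "odd k"
    and W_graded: "graded_subspace A W" and W_subset: "W \<subseteq> V"
    and V_sum: "V = vspan A {x} <+>\<^bsub>A\<^esub> W" and V_int: "vspan A {x} \<inter> W = {\<zero>}"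
begin

lemma x_carrier [simp]: "x \<in> carrier A"
  using x_homog by (rule homog_carrier)

lemma W_submodule: "submodule W rat_field A"
  using W_graded by (simp add: graded_subspace_def)

lemma W_carrier: "w \<in> W \<Longrightarrow> w \<in> carrier A"
  using submoduleD(1)[OF W_submodule] by blast

lemma V_iff: "v \<in> V \<longleftrightarrow> (\<exists>q. \<exists>w\<in>W. v = q \<odot> x \<oplus> w)"
  by (subst V_sum) (auto simp: set_add_def' vspan_singleton)

lemma smult_x_in_W: "q \<odot> x \<in> W \<Longrightarrow> q \<odot> x = \<zero>"
  using V_int by (auto simp: vspan_singleton)

text \<open>Subtracting the two expressions puts \<open>(q - q') \<odot> x\<close> into
  \<open>W\<close>, which contains no nonzero multiple of \<open>x\<close>. The scalars are not
  compared, since \<open>x\<close> could be zero in this locale.\<close>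

lemma split_unique:
  assumes "w \<in> W" "w' \<in> W" "q \<odot> x \<oplus> w = q' \<odot> x \<oplus> w'"
  shows "w = w'"
proof -
  have c: "w \<in> carrier A" "w' \<in> carrier A" using assms W_carrier by auto
  have "(q - q') \<odot> x = q \<odot> x \<ominus> q' \<odot> x"
    using smult_add_left[of x q "- q'"] smult_smult[of x "-1" q'] by (simp add: a_minus_def)
  also have "\<dots> = (q \<odot> x \<oplus> w) \<oplus> (\<ominus> (q' \<odot> x) \<oplus> \<ominus> w)"
    using c by (simp add: a_minus_def a_ac r_neg1 r_neg2)
  also have "\<dots> = w' \<ominus> w"
    unfolding assms(3) using c by (simp add: a_minus_def a_ac r_neg r_neg2)
  finally have eq: "(q - q') \<odot> x = w' \<ominus> w" .
  also have "w' \<ominus> w \<in> W" using submoduleD(6)[OF W_submodule] assms by blast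
  finally have "(q - q') \<odot> x = \<zero>" by (rule smult_x_in_W)
  then have "w' \<ominus> w = \<zero>" using eq by simp
  then show ?thesis using c by simp
qed

text \<open>If the degree of \<open>v\<close> is not \<open>k\<close>, then the negative of
  \<open>q \<odot> x\<close> is the degree \<open>k\<close> component of \<open>w\<close>. As
  \<open>W\<close> is graded it lies in \<open>W\<close>, which forces it to be zero.\<close>

lemma split_homog:
  assumes "v \<in> V" and v: "v \<in> homog A j"
  shows "\<exists>q. \<exists>w\<in>W. v = q \<odot> x \<oplus> w \<and> w \<in> homog A j \<and> (q = 0 \<or> j = k)"
proof -
  obtain q w where w: "w \<in> W" and eq: "v = q \<odot> x \<oplus> w" using assms(1) V_iff by blast
  have c: "w \<in> carrier A" "v \<in> carrier A" using w W_carrier v by auto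
  have weq: "w = \<ominus> (q \<odot> x) \<oplus> v" unfolding eq using c by (simp add: r_neg1)
  have qx: "\<ominus> (q \<odot> x) \<in> homog A k" using x_homog homog_closed(4,5) by blast
  show ?thesis
  proof (cases "j = k")
    case True
    have "w \<in> homog A j" unfolding weq using qx v True homog_closed(3) by blast
    then show ?thesis using w eq True by blast
  next
    case False
    have "homog_decomp A (v \<oplus> \<zero>) ((\<lambda>_. \<zero>)(j := v \<oplus> \<zero>))"
      using decomp_homog_add[OF v decomp_zero] .
    then have "homog_decomp A v ((\<lambda>_. \<zero>)(j := v))" using c by simp
    from decomp_homog_add[OF qx this]
    have "homog_decomp A w ((\<lambda>_. \<zero>)(j := v, k := \<ominus> (q \<odot> x)))"
      using False weq by simp
    then have "((\<lambda>_. \<zero>)(j := v, k := \<ominus> (q \<odot> x))) k \<in> W"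
      using W_graded w unfolding graded_subspace_def by blast
    then have "q \<odot> x \<in> W" using submoduleD(5)[OF W_submodule, of "\<ominus> (q \<odot> x)"] by simp
    then have "w = v" unfolding eq using smult_x_in_W c by simp
    then show ?thesis using w v c by (intro exI[of _ 0] bexI[of _ w]) auto
  qed
qed

text \<open>The projection of \<open>V\<close> onto \<open>W\<close> along \<open>x\<close> is
  linear and preserves degrees, so freeness extends it to an endomorphism of \<open>A\<close>. That
  its values lie in \<Lambda>W is shown in \<open>\<pi>_image\<close>.\<close>

lemma ex_retraction:
  "\<exists>\<pi>. \<pi> \<in> graded_alg_hom A A \<and> \<pi> x = \<zero> \<and> (\<forall>w\<in>W. \<pi> w = w)"
proof -
  have "\<forall>v\<in>V. \<exists>w. w \<in> W \<and> (\<exists>q. v = q \<odot> x \<oplus> w)" using V_iff by blast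
  then obtain f where f: "\<And>v. v \<in> V \<Longrightarrow> f v \<in> W" "\<And>v. v \<in> V \<Longrightarrow> \<exists>q. v = q \<odot> x \<oplus> f v"
    using bchoice[of V] by metis
  \<comment> \<open>By \<open>split_unique\<close> the chosen \<open>f\<close> does not depend on
    the representation of \<open>v\<close>, so linearity reduces to exhibiting representations of
    sums and multiples.\<close>
  have f_eq: "f v = w" if "w \<in> W" "v = q \<odot> x \<oplus> w" for v w q
  proof -
    have "v \<in> V" using that V_iff by blast
    obtain q' where "v = q' \<odot> x \<oplus> f v" using f(2)[OF \<open>v \<in> V\<close>] ..
    then show ?thesis using split_unique[of "f v" w q' q] f(1)[OF \<open>v \<in> V\<close>] that by metis
  qed
  have "linear_map_on A V A f"
    unfolding linear_map_on_def
  proof (intro conjI ballI allI)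
    show "f \<in> V \<rightarrow> carrier A" using f(1) W_carrier by blast
  next
    fix u v assume uv: "u \<in> V" "v \<in> V"
    obtain p where p: "u = p \<odot> x \<oplus> f u" using f(2)[OF uv(1)] ..
    obtain q where q: "v = q \<odot> x \<oplus> f v" using f(2)[OF uv(2)] ..
    note * = p q f(1)[OF uv(1)] f(1)[OF uv(2)]
    have "u \<oplus> v = (p \<odot> x \<oplus> f u) \<oplus> (q \<odot> x \<oplus> f v)"
      by (rule arg_cong2[where f = "ring.add A", OF *(1,2)])
    also have "\<dots> = (p + q) \<odot> x \<oplus> (f u \<oplus> f v)"
      using W_carrier[OF *(3)] W_carrier[OF *(4)] by (simp add: smult_add_left a_ac)
    finally show "f (u \<oplus> v) = f u \<oplus> f v"
      using submoduleD(3)[OF W_submodule *(3,4)] by (intro f_eq)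
  next
    fix q v assume v: "v \<in> V"
    obtain p where p: "v = p \<odot> x \<oplus> f v" using f(2)[OF v] ..
    note * = p f(1)[OF v]
    have "q \<odot> v = q \<odot> (p \<odot> x \<oplus> f v)"
      by (rule arg_cong[where f = "module.smult A q", OF *(1)])
    also have "\<dots> = (q * p) \<odot> x \<oplus> q \<odot> f v"
      using W_carrier[OF *(2)] by (simp add: smult_add_right smult_smult)
    finally show "f (q \<odot> v) = q \<odot> f v"
      using submoduleD(4)[OF W_submodule *(2)] by (intro f_eq)
  qed
  moreover have "f v \<in> homog A j" if v: "v \<in> V" "v \<in> homog A j" for v j
  proof -
    obtain q w where "w \<in> W" "v = q \<odot> x \<oplus> w" "w \<in> homog A j" using split_homog[OF v] by blast
    then show ?thesis using f_eq by simp
  qed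
  ultimately obtain g where g: "g \<in> graded_alg_hom A A" "\<forall>v\<in>V. g v = f v"
    using ex1_extension[OF gca] by blast
  have "\<zero> \<in> W" "x = 1 \<odot> x \<oplus> \<zero>" using submoduleD(2)[OF W_submodule] by simp_all
  then have "x \<in> V" "f x = \<zero>"
    using f_eq[of \<zero> x 1] V_iff[of x] by metis+
  moreover have "f w = w" if "w \<in> W" for w
    using f_eq[of w w 0] that W_carrier[OF that] by simp
  ultimately show ?thesis using g W_subset by (intro exI[of _ g]) auto
qed

lemma hom_eqI_split:
  assumes f: "f \<in> graded_alg_hom A A" and g: "g \<in> graded_alg_hom A A"
    and eq: "f x = g x" "\<And>w. w \<in> W \<Longrightarrow> f w = g w" and a: "a \<in> carrier A"
  shows "f a = g a"
proof (rule hom_eqI[OF f g _ a])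
  fix v assume "v \<in> V"
  then obtain q w where v: "w \<in> W" "v = q \<odot> x \<oplus> w" using V_iff by blast
  then show "f v = g v"
    using eq W_carrier[OF v(1)] by (simp add: hom_add[OF f] hom_add[OF g] hom_smult[OF f] hom_smult[OF g])
qed

end

section \<open>The retraction onto the subalgebra generated by \<open>W\<close>\<close>

locale retraction = split_generator +
  fixes \<pi> :: "'a \<Rightarrow> 'a"
  assumes hom: "\<pi> \<in> graded_alg_hom A A" and \<pi>_x: "\<pi> x = \<zero>" and \<pi>_W: "w \<in> W \<Longrightarrow> \<pi> w = w"
begin

lemma \<pi>_closed [simp]: "a \<in> carrier A \<Longrightarrow> \<pi> a \<in> carrier A"
  using hom by (rule hom_closed)

text \<open>As simp rules, \<open>x_mid\<close>, \<open>x_x\<close> and their primed versions remove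
  right-associated products in which \<open>x\<close> occurs twice with at most one factor in
  between.\<close>

lemma x_mid [simp]: "a \<in> carrier A \<Longrightarrow> x \<otimes> (a \<otimes> x) = \<zero>"
  using odd_mid_zero[OF x_homog k_odd] .

lemma x_mid' [simp]: "a \<in> carrier A \<Longrightarrow> b \<in> carrier A \<Longrightarrow> x \<otimes> (a \<otimes> (x \<otimes> b)) = \<zero>"
  using x_mid[of a] m_assoc[of x "a \<otimes> x" b] m_assoc[of a x b] by simp

lemma x_x [simp]: "x \<otimes> x = \<zero>"
  using odd_square_zero[OF x_homog k_odd] .

lemma x_x' [simp]: "b \<in> carrier A \<Longrightarrow> x \<otimes> (x \<otimes> b) = \<zero>"
  using m_assoc[of x x b] by simp

text \<open>The elements of this form make up a graded subalgebra containing \<open>V\<close>, hence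
  everything. The degree of \<open>q\<close> is recorded because \<open>\<pi>_dx\<close> relies on
  it.\<close>

lemma homog_remainder:
  assumes "a \<in> homog A j"
  shows "\<exists>q\<in>homog A (j - k). a = \<pi> a \<oplus> x \<otimes> q"
proof -
  define S where "S j = {a \<in> homog A j. \<exists>q\<in>homog A (j - k). a = \<pi> a \<oplus> x \<otimes> q}" for j
  have "graded_subalgebra A S"
  proof (intro graded_subalgebra.intro gc_algebra_axioms graded_subalgebra_axioms.intro, goal_cases)
    case (1 j)
    then show ?case by (auto simp: S_def)
  next
    case (2 j)
    show ?case
    proof (rule submoduleI)
      show "S j \<subseteq> carrier A" by (auto simp: S_def)
      show "\<zero> \<in> S j"
        using homog_closed(2) by (auto simp: S_def hom_zero[OF hom] intro!: bexI[of _ \<zero>])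
    next
      fix a b assume "a \<in> S j" "b \<in> S j"
      then obtain q r where ab: "a \<in> homog A j" "b \<in> homog A j"
        and qr: "q \<in> homog A (j - k)" "r \<in> homog A (j - k)"
        and eq: "a = \<pi> a \<oplus> x \<otimes> q" "b = \<pi> b \<oplus> x \<otimes> r" by (auto simp: S_def)
      have c: "a \<in> carrier A" "b \<in> carrier A" "q \<in> carrier A" "r \<in> carrier A"
        using ab qr by auto
      have "a \<oplus> b = (\<pi> a \<oplus> x \<otimes> q) \<oplus> (\<pi> b \<oplus> x \<otimes> r)"
        by (rule arg_cong2[where f = "ring.add A", OF eq])
      also have "\<dots> = \<pi> (a \<oplus> b) \<oplus> x \<otimes> (q \<oplus> r)"
        using c by (simp add: hom_add[OF hom] r_distr a_ac)
      finally show "a \<oplus> b \<in> S j" using ab qr homog_closed(3) by (auto simp: S_def)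
    next
      fix p a assume "a \<in> S j"
      then obtain q where a: "a \<in> homog A j" and q: "q \<in> homog A (j - k)"
        and eq: "a = \<pi> a \<oplus> x \<otimes> q" by (auto simp: S_def)
      have c: "a \<in> carrier A" "q \<in> carrier A" using a q by auto
      have "p \<odot> a = p \<odot> (\<pi> a \<oplus> x \<otimes> q)"
        by (rule arg_cong[where f = "module.smult A p", OF eq])
      also have "\<dots> = \<pi> (p \<odot> a) \<oplus> x \<otimes> (p \<odot> q)"
        using c by (simp add: hom_smult[OF hom] smult_add_right smult_mult_right)
      finally show "p \<odot> a \<in> S j" using a q homog_closed(4) by (auto simp: S_def)
    qed
  next
    case 3
    then show ?case
      using homog_one homog_closed(2)
      by (auto simp: S_def hom_one[OF hom] intro!: bexI[of _ \<zero>])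
  next
    case (4 a i b j)
    then obtain q r where ab: "a \<in> homog A i" "b \<in> homog A j"
      and qr: "q \<in> homog A (i - k)" "r \<in> homog A (j - k)"
      and eq: "a = \<pi> a \<oplus> x \<otimes> q" "b = \<pi> b \<oplus> x \<otimes> r" by (auto simp: S_def)
    have c: "a \<in> carrier A" "b \<in> carrier A" "q \<in> carrier A" "r \<in> carrier A"
      using ab qr by auto
    have \<pi>ab: "\<pi> a \<in> homog A i" "\<pi> b \<in> homog A j" using hom_homog[OF hom] ab by auto
    \<comment> \<open>The product expands to \<open>\<pi> a \<otimes> \<pi> b\<close> and two mixed
      terms, the term with two factors \<open>x\<close> being zero. Exchanging
      \<open>\<pi> a\<close> with \<open>x\<close> turns the mixed terms into \<open>x\<close> times
      this cofactor.\<close>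
    let ?s = "(-1) powi (i * k) \<odot> (\<pi> a \<otimes> r) \<oplus> q \<otimes> \<pi> b"
    have "a \<otimes> b = (\<pi> a \<oplus> x \<otimes> q) \<otimes> (\<pi> b \<oplus> x \<otimes> r)"
      by (rule arg_cong2[where f = "monoid.mult A", OF eq])
    also have "\<dots> = \<pi> (a \<otimes> b) \<oplus> ((\<pi> a \<otimes> x) \<otimes> r \<oplus> x \<otimes> (q \<otimes> \<pi> b))"
      using c by (simp add: hom_mult[OF hom] l_distr r_distr m_assoc a_ac)
    also have "\<pi> a \<otimes> x = (-1) powi (i * k) \<odot> (x \<otimes> \<pi> a)"
      using \<pi>ab(1) x_homog by (rule homog_commute)
    also have "((-1) powi (i * k) \<odot> (x \<otimes> \<pi> a)) \<otimes> r \<oplus> x \<otimes> (q \<otimes> \<pi> b) = x \<otimes> ?s"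
      using c by (simp add: r_distr smult_mult_left smult_mult_right m_assoc)
    finally have "a \<otimes> b = \<pi> (a \<otimes> b) \<oplus> x \<otimes> ?s" .
    moreover have "?s \<in> homog A (i + j - k)"
    proof -
      have "\<pi> a \<otimes> r \<in> homog A (i + j - k)" "q \<otimes> \<pi> b \<in> homog A (i + j - k)"
        using homog_mult[OF \<pi>ab(1) qr(2)] homog_mult[OF qr(1) \<pi>ab(2)] by (simp_all add: algebra_simps)
      then show ?thesis by (intro homog_closed(3,4))
    qed
    ultimately show ?case using homog_mult[OF ab] by (auto simp: S_def)
  qed
  moreover have "V \<inter> homog A j \<subseteq> S j" for j
  proof
    fix v assume v: "v \<in> V \<inter> homog A j"
    then obtain q w where w: "w \<in> W" "v = q \<odot> x \<oplus> w" "q = 0 \<or> j = k"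
      using split_homog[of v j] by blast
    note wc = W_carrier[OF w(1)]
    have "\<pi> v = w" using w(2) wc by (simp add: hom_add[OF hom] hom_smult[OF hom] \<pi>_x \<pi>_W[OF w(1)])
    \<comment> \<open>Either \<open>q\<close> is zero, or \<open>j = k\<close> and a multiple of the
      unit has the required degree 0.\<close>
    then have "v = \<pi> v \<oplus> x \<otimes> (q \<odot> \<one>)" using w(2) wc by (simp add: smult_mult_right a_comm)
    moreover have "q \<odot> \<one> \<in> homog A (j - k)"
      using w(3) homog_closed(2,4) homog_one by auto
    ultimately show "v \<in> S j" using v by (auto simp: S_def)
  qed
  ultimately have "homog A j \<subseteq> S j" by (rule homog_subset_subalgebra)
  then show ?thesis using assms by (auto simp: S_def)
qed

lemma remainder:
  assumes "a \<in> carrier A"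
  obtains q where "q \<in> carrier A" "a = \<pi> a \<oplus> x \<otimes> q"
proof -
  have "\<exists>q\<in>carrier A. a = \<pi> a \<oplus> x \<otimes> q"
    using assms
  proof (induction rule: homog_induct)
    case zero
    then show ?case by (intro bexI[of _ \<zero>]) (simp_all add: hom_zero[OF hom])
  next
    case (add j s b)
    obtain q where q: "q \<in> carrier A" "s = \<pi> s \<oplus> x \<otimes> q"
      using homog_remainder[OF add(1)] homog_carrier by blast
    obtain r where r: "r \<in> carrier A" "b = \<pi> b \<oplus> x \<otimes> r" using add(3) by blast
    have c: "s \<in> carrier A" "b \<in> carrier A" using add(1,2) by auto
    have "s \<oplus> b = (\<pi> s \<oplus> x \<otimes> q) \<oplus> (\<pi> b \<oplus> x \<otimes> r)"
      by (rule arg_cong2[where f = "ring.add A", OF q(2) r(2)])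
    also have "\<dots> = \<pi> (s \<oplus> b) \<oplus> x \<otimes> (q \<oplus> r)"
      using c q(1) r(1) by (simp add: hom_add[OF hom] r_distr a_ac)
    finally show ?case using q(1) r(1) by blast
  qed
  then show ?thesis using that by blast
qed

lemma \<pi>_x_mult [simp]: "a \<in> carrier A \<Longrightarrow> \<pi> (x \<otimes> a) = \<zero>"
  by (simp add: hom_mult[OF hom] \<pi>_x)

text \<open>The elements \<open>a\<close> and \<open>\<pi> a\<close> differ by a multiple of
  \<open>x\<close>, and \<open>x\<close> squares to zero.\<close>

lemma x_\<pi>: "a \<in> carrier A \<Longrightarrow> x \<otimes> \<pi> a = x \<otimes> a"
proof -
  assume a: "a \<in> carrier A"
  then obtain q where q: "q \<in> carrier A" "a = \<pi> a \<oplus> x \<otimes> q" by (rule remainder)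
  have "x \<otimes> a = x \<otimes> (\<pi> a \<oplus> x \<otimes> q)"
    by (rule arg_cong[where f = "monoid.mult A x", OF q(2)])
  then show ?thesis using a q(1) by (simp add: r_distr)
qed

text \<open>The elements sent into \<Lambda>W form a graded subalgebra, which contains
  \<open>V\<close> because \<pi> maps \<open>V\<close> into \<open>W\<close>.\<close>

lemma \<pi>_image: "a \<in> carrier A \<Longrightarrow> \<pi> a \<in> carrier (gen_subalg A W)"
proof -
  assume a: "a \<in> carrier A"
  define S where "S j = {a \<in> homog A j. \<pi> a \<in> carrier (gen_subalg A W)}" for j
  have W: "W \<subseteq> carrier A" using W_carrier by blast
  note cl = gen_subalg_closed[where W = W]
  have "graded_subalgebra A S"
  proof (intro graded_subalgebra.intro gc_algebra_axioms graded_subalgebra_axioms.intro, goal_cases)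
    case (2 j)
    show ?case
      by (rule submoduleI)
        (auto simp: S_def hom_zero[OF hom] hom_add[OF hom] hom_smult[OF hom]
          intro: cl homog_closed(2-4))
  qed (auto simp: S_def hom_one[OF hom] hom_mult[OF hom] homog_one intro: cl homog_mult)
  moreover have "V \<inter> homog A j \<subseteq> S j" for j
  proof
    fix v assume v: "v \<in> V \<inter> homog A j"
    then obtain q w where w: "w \<in> W" "v = q \<odot> x \<oplus> w" using V_iff by blast
    have "\<pi> v = w"
      using w(2) W_carrier[OF w(1)] by (simp add: hom_add[OF hom] hom_smult[OF hom] \<pi>_x \<pi>_W[OF w(1)])
    then show "v \<in> S j" using v w(1) cl(1) by (auto simp: S_def)
  qed
  ultimately have *: "homog A j \<subseteq> S j" for j by (rule homog_subset_subalgebra)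
  show ?thesis
    using a
  proof (induction rule: homog_induct)
    case zero
    then show ?case by (simp add: hom_zero[OF hom] cl)
  next
    case (add j s b)
    have "\<pi> s \<in> carrier (gen_subalg A W)" using * add(1) by (auto simp: S_def)
    then show ?case using add cl(5) homog_carrier[OF add(1)] by (simp add: hom_add[OF hom])
  qed
qed

lemma gen_subalg_carrier: "a \<in> carrier (gen_subalg A W) \<Longrightarrow> a \<in> carrier A"
  using gen_subalg_subset[of W] W_carrier by blast

lemma \<pi>_gen_subalg: "a \<in> carrier (gen_subalg A W) \<Longrightarrow> \<pi> a = a"
  using gen_subalg_minimal[of W "{a \<in> carrier A. \<pi> a = a}"] hom_fixed_points[OF hom] \<pi>_W W_carrier
  by blast

lemma Der_\<pi>: "\<eta> \<in> Der A j \<Longrightarrow> (\<lambda>a. \<pi> (\<eta> a)) \<in> Der (gen_subalg A W) j"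
  by (rule Der_retract[OF hom]) (use \<pi>_W W_carrier \<pi>_image in auto)

end

section \<open>Conjugation by the automorphism\<close>

text \<open>The degrees 0 and at least 2 are closed under addition, so keeping just these pieces
  gives a graded subalgebra; it contains \<open>V\<close> by assumption.\<close>

lemma (in free_algebra) homog_one_trivial:
  assumes "\<And>j. j < 2 \<Longrightarrow> V \<inter> homog A j = {\<zero>}"
  shows "homog A 1 = {\<zero>}"
proof -
  \<comment> \<open>Negative degrees are dropped as well: a product of elements of degrees 2 and -1
    would land in degree 1.\<close>
  define S where "S j = (if j = 0 \<or> 2 \<le> j then homog A j else {\<zero>})" for j :: int
  have S_sub: "S j \<subseteq> homog A j" for j using homog_closed(2) by (simp add: S_def)
  have "graded_subalgebra A S"
  proof (intro graded_subalgebra.intro gc_algebra_axioms graded_subalgebra_axioms.intro, goal_cases)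
    case (1 j)
    show ?case by (rule S_sub)
  next
    case (2 j)
    have "submodule {\<zero>} rat_field A" by (rule submoduleI) auto
    then show ?case using submodule_homog by (simp add: S_def)
  next
    case 3
    show ?case using homog_one by (simp add: S_def)
  next
    case (4 a i b j)
    have ab: "a \<in> homog A i" "b \<in> homog A j" using 4 S_sub by blast+
    then have ab': "a \<in> carrier A" "b \<in> carrier A" by auto
    show ?case
    proof (cases "(i = 0 \<or> 2 \<le> i) \<and> (j = 0 \<or> 2 \<le> j)")
      case True
      then have "S (i + j) = homog A (i + j)" by (auto simp: S_def)
      then show ?thesis using homog_mult[OF ab] by simp
    next
      case False
      then have "a = \<zero> \<or> b = \<zero>" using 4 by (auto simp: S_def split: if_splits)
      then have "a \<otimes> b = \<zero>" using ab' by auto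
      then show ?thesis using homog_closed(2) by (simp add: S_def)
    qed
  qed
  moreover have "V \<inter> homog A j \<subseteq> S j" for j
    using assms[of j] by (cases "j < 2") (auto simp: S_def)
  ultimately have "homog A 1 \<subseteq> S 1" by (rule homog_subset_subalgebra)
  then show ?thesis using homog_closed(2) by (auto simp: S_def)
qed

text \<open>\<open>cycle\<close> is the cycle condition with its sign evaluated for odd
  \<open>k\<close>; \<open>homog_1\<close> is what remains of the assumption that \<open>V\<close>
  starts in degree 2.\<close>

locale gottlieb = retraction +
  fixes \<theta> d :: "'a \<Rightarrow> 'a"
  assumes \<theta>: "\<theta> \<in> Der A k" and \<theta>_x: "\<theta> x = \<one>"
    and d: "d \<in> Der A (-1)" and cycle: "a \<in> carrier A \<Longrightarrow> d (\<theta> a) = \<ominus> \<theta> (d a)"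
    and homog_1: "homog A 1 = {\<zero>}"
begin

definition D :: "'a \<Rightarrow> 'a" where "D a = x \<otimes> \<theta> a"

text \<open>The inner \<pi> keeps \<open>x\<close> fixed: since \<open>D x = x\<close>, the map 1 -
  \<open>D\<close> would send \<open>x\<close> to zero.\<close>

definition \<Phi> :: "'a \<Rightarrow> 'a" where "\<Phi> a = a \<ominus> D (\<pi> a)"

definition \<Psi> :: "'a \<Rightarrow> 'a" where "\<Psi> a = a \<oplus> D (\<pi> a)"

lemma \<theta>_closed [simp]: "a \<in> carrier A \<Longrightarrow> \<theta> a \<in> carrier A"
  using \<theta> by (rule Der_closed)

lemma d_closed [simp]: "a \<in> carrier A \<Longrightarrow> d a \<in> carrier A"
  using d by (rule Der_closed)

lemma D_closed [simp]: "a \<in> carrier A \<Longrightarrow> D a \<in> carrier A"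
  by (simp add: D_def)

lemma D_Der: "D \<in> Der A 0"
  using Der_left_mult[OF x_homog \<theta>] by (simp add: D_def[abs_def])

lemma D_mult: "a \<in> carrier A \<Longrightarrow> b \<in> carrier A \<Longrightarrow> D (a \<otimes> b) = D a \<otimes> b \<oplus> a \<otimes> D b"
  by (rule Der_zero_mult[OF D_Der])

lemma \<theta>_x_mult: "a \<in> carrier A \<Longrightarrow> \<theta> (x \<otimes> a) = a \<ominus> x \<otimes> \<theta> a"
  using Der_mult[OF \<theta> x_homog] k_odd
  by (simp add: \<theta>_x powi_minus_one_odd a_minus_def)

lemma D_x_mult [simp]: "a \<in> carrier A \<Longrightarrow> D (x \<otimes> a) = x \<otimes> a"
  unfolding D_def by (simp add: \<theta>_x_mult a_minus_def r_distr r_minus)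

lemma \<pi>_D [simp]: "a \<in> carrier A \<Longrightarrow> \<pi> (D a) = \<zero>"
  by (simp add: D_def)

lemma D_zero [simp]: "D \<zero> = \<zero>"
  using D_x_mult[of \<zero>] by simp

text \<open>In the splitting of \<open>a\<close> into \<open>\<pi> a\<close> and a multiple of
  \<open>x\<close>, the derivation \<open>D\<close> fixes that multiple. Hence it equals
  \<open>D a \<ominus> D (\<pi> a)\<close>.\<close>

lemma remainder_D: "a \<in> carrier A \<Longrightarrow> a \<ominus> D a \<oplus> D (\<pi> a) = \<pi> a"
proof -
  assume a: "a \<in> carrier A"
  then obtain q where q: "q \<in> carrier A" "a = \<pi> a \<oplus> x \<otimes> q" by (rule remainder)
  have "D a = D (\<pi> a \<oplus> x \<otimes> q)" by (rule arg_cong[where f = D, OF q(2)])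
  also have "\<dots> = D (\<pi> a) \<oplus> x \<otimes> q" using a q(1) by (simp add: Der_add[OF D_Der])
  finally have Da: "D a = D (\<pi> a) \<oplus> x \<otimes> q" .
  have "a \<oplus> D (\<pi> a) = \<pi> a \<oplus> D a"
    unfolding Da using a q(1)
    by (subst q(2)) (simp add: a_ac)
  then have "a \<oplus> D (\<pi> a) \<ominus> D a = \<pi> a"
    using a by (simp add: a_minus_def a_assoc r_neg)
  then show ?thesis using a by (simp add: a_minus_def a_ac)
qed

text \<open>Every value of \<open>D\<close> is a multiple of \<open>x\<close>, so multiples of
  \<open>x\<close> in the other factor contribute nothing.\<close>

lemma D_\<pi>_mult:
  assumes "a \<in> carrier A" "b \<in> carrier A"
  shows "D (\<pi> a) \<otimes> \<pi> b = D (\<pi> a) \<otimes> b" "\<pi> a \<otimes> D (\<pi> b) = a \<otimes> D (\<pi> b)"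
    "D a \<otimes> D b = \<zero>"
proof -
  obtain q where q: "q \<in> carrier A" "b = \<pi> b \<oplus> x \<otimes> q" using assms(2) by (rule remainder)
  have "D (\<pi> a) \<otimes> b = D (\<pi> a) \<otimes> (\<pi> b \<oplus> x \<otimes> q)"
    by (rule arg_cong[where f = "monoid.mult A (D (\<pi> a))", OF q(2)])
  then show "D (\<pi> a) \<otimes> \<pi> b = D (\<pi> a) \<otimes> b"
    using assms q(1) by (simp add: r_distr D_def m_assoc)
  obtain r where r: "r \<in> carrier A" "a = \<pi> a \<oplus> x \<otimes> r" using assms(1) by (rule remainder)
  have "a \<otimes> D (\<pi> b) = (\<pi> a \<oplus> x \<otimes> r) \<otimes> D (\<pi> b)"
    by (rule arg_cong[where f = "\<lambda>a. a \<otimes> D (\<pi> b)", OF r(2)])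
  then show "\<pi> a \<otimes> D (\<pi> b) = a \<otimes> D (\<pi> b)"
    using assms r(1) by (simp add: l_distr D_def m_assoc)
  show "D a \<otimes> D b = \<zero>" using assms by (simp add: D_def m_assoc)
qed

lemma \<Phi>_closed [simp]: "a \<in> carrier A \<Longrightarrow> \<Phi> a \<in> carrier A"
  by (simp add: \<Phi>_def)

lemma \<Psi>_closed [simp]: "a \<in> carrier A \<Longrightarrow> \<Psi> a \<in> carrier A"
  by (simp add: \<Psi>_def)

text \<open>Since \<pi> annihilates the values of \<open>D\<close>, the composite of
  \<open>D\<close> after \<pi> squares to zero.\<close>

lemma \<Psi>_\<Phi>: "a \<in> carrier A \<Longrightarrow> \<Psi> (\<Phi> a) = a"
  by (simp add: \<Psi>_def \<Phi>_def hom_add[OF hom] hom_minus[OF hom] a_minus_def a_assoc l_neg)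

lemma \<Phi>_\<Psi>: "a \<in> carrier A \<Longrightarrow> \<Phi> (\<Psi> a) = a"
  by (simp add: \<Psi>_def \<Phi>_def hom_add[OF hom] a_minus_def a_assoc r_neg)

lemma \<Phi>_hom: "\<Phi> \<in> graded_alg_hom A A"
  unfolding graded_alg_hom_iff
proof (intro conjI ballI allI)
  fix a b assume ab: "a \<in> carrier A" "b \<in> carrier A"
  show "\<Phi> (a \<oplus> b) = \<Phi> a \<oplus> \<Phi> b"
    using ab by (simp add: \<Phi>_def hom_add[OF hom] Der_add[OF D_Der] a_minus_def minus_add a_ac)
  \<comment> \<open>By \<open>D_\<pi>_mult\<close>, \<open>D\<close> after \<pi> obeys the Leibniz
    rule on all of \<open>A\<close>; the quadratic term of
    \<open>\<Phi> a \<otimes> \<Phi> b\<close> is zero.\<close>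
  have "D (\<pi> (a \<otimes> b)) = D (\<pi> a) \<otimes> b \<oplus> a \<otimes> D (\<pi> b)"
    using ab by (simp add: hom_mult[OF hom] D_mult D_\<pi>_mult)
  then show "\<Phi> (a \<otimes> b) = \<Phi> a \<otimes> \<Phi> b"
    using ab
    by (simp add: \<Phi>_def a_minus_def l_distr r_distr l_minus r_minus minus_add D_\<pi>_mult(3) a_ac)
next
  fix q a assume "a \<in> carrier A"
  then show "\<Phi> (q \<odot> a) = q \<odot> \<Phi> a"
    by (simp add: \<Phi>_def hom_smult[OF hom] Der_smult[OF D_Der] a_minus_def smult_add_right
        smult_minus_right)
next
  show "\<Phi> \<one> = \<one>" by (simp add: \<Phi>_def hom_one[OF hom] Der_one[OF D_Der] a_minus_def)
next
  fix j a assume a: "a \<in> homog A j"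
  have "D (\<pi> a) \<in> homog A j" using Der_homog[OF D_Der hom_homog[OF hom a]] by simp
  then show "\<Phi> a \<in> homog A j" unfolding \<Phi>_def by (rule homog_closed(6)[OF a])
qed simp

lemma \<Phi>_bij: "bij_betw \<Phi> (carrier A) (carrier A)"
  by (rule bij_betw_byWitness[of _ \<Psi>]) (auto simp: \<Psi>_\<Phi> \<Phi>_\<Psi>)

lemma \<Phi>_x: "\<Phi> x = x"
  by (simp add: \<Phi>_def \<pi>_x a_minus_def)

lemma \<Phi>_W: "w \<in> W \<Longrightarrow> \<Phi> w = w \<ominus> x \<otimes> \<theta> w"
  by (simp add: \<Phi>_def \<pi>_W D_def)

lemma eq_\<Phi>:
  assumes "\<phi> \<in> graded_alg_hom A A" "\<phi> x = x" "\<And>w. w \<in> W \<Longrightarrow> \<phi> w = w \<ominus> x \<otimes> \<theta> w" "a \<in> carrier A"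
  shows "\<phi> a = \<Phi> a"
  by (rule hom_eqI_split[OF assms(1) \<Phi>_hom]) (simp_all add: assms \<Phi>_x \<Phi>_W)

lemma ex1_automorphism:
  "\<exists>!\<phi>. \<phi> \<in> extensional (carrier A) \<and> \<phi> \<in> graded_alg_aut A \<and>
     \<phi> x = x \<and> (\<forall>v \<in> W. \<phi> v = v \<ominus> x \<otimes> \<theta> v)"
proof (rule ex1I[of _ "restrict \<Phi> (carrier A)"])
  have "bij_betw (restrict \<Phi> (carrier A)) (carrier A) (carrier A)"
    using \<Phi>_bij by (simp add: bij_betw_restrict_eq)
  then show "restrict \<Phi> (carrier A) \<in> extensional (carrier A) \<and>
      restrict \<Phi> (carrier A) \<in> graded_alg_aut A \<and> restrict \<Phi> (carrier A) x = x \<and>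
      (\<forall>v \<in> W. restrict \<Phi> (carrier A) v = v \<ominus> x \<otimes> \<theta> v)"
    using hom_restrict[OF \<Phi>_hom] \<Phi>_x \<Phi>_W W_carrier by (simp add: graded_alg_aut_def)
next
  fix \<phi> assume *: "\<phi> \<in> extensional (carrier A) \<and> \<phi> \<in> graded_alg_aut A \<and>
     \<phi> x = x \<and> (\<forall>v \<in> W. \<phi> v = v \<ominus> x \<otimes> \<theta> v)"
  then have "\<phi> a = \<Phi> a" if "a \<in> carrier A" for a
    using that by (intro eq_\<Phi>) (auto simp: graded_alg_aut_def)
  then show "\<phi> = restrict \<Phi> (carrier A)"
    using * by (intro extensionalityI[of _ "carrier A"]) auto
qed

text \<open>At \<open>x\<close> the cycle condition compares it with \<open>d \<one>\<close>, which
  is zero.\<close>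

lemma \<theta>_dx: "\<theta> (d x) = \<zero>"
proof -
  have "\<ominus> \<theta> (d x) = \<zero>" using cycle[of x] Der_one[OF d] by (simp add: \<theta>_x)
  then show ?thesis using minus_minus[of "\<theta> (d x)"] by simp
qed

lemma D_dx: "D (d x) = \<zero>"
  by (simp add: D_def \<theta>_dx)

lemma dx_homog: "d x \<in> homog A (k + 1)"
  using Der_homog[OF d x_homog] by simp

text \<open>
  The coefficient of \<open>x\<close> in \<open>d x\<close> has degree 1, and there are no nonzero such elements.
\<close>

lemma \<pi>_dx: "\<pi> (d x) = d x"
proof -
  obtain q where "q \<in> homog A 1" "d x = \<pi> (d x) \<oplus> x \<otimes> q"
    using homog_remainder[OF dx_homog] by auto
  then show ?thesis using homog_1 by simp
qed

text \<open>The degree \<open>k + 1\<close> of \<open>d x\<close> is even, so no sign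
  arises.\<close>

lemma dx_commute: "a \<in> carrier A \<Longrightarrow> d x \<otimes> a = a \<otimes> d x"
proof (induction rule: homog_induct)
  case zero
  then show ?case by simp
next
  case (add j s b)
  have "d x \<otimes> s = s \<otimes> d x"
    using homog_commute[OF dx_homog add(1)] k_odd homog_carrier[OF add(1)]
    by (simp add: powi_minus_one_even)
  then show ?case using add homog_carrier[OF add(1)] by (simp add: l_distr r_distr)
qed

text \<open>The sign from passing \<open>d\<close> over the odd \<open>x\<close> and the sign in
  \<open>cycle\<close> cancel. Thus the commutator of \<open>d\<close> and \<open>D\<close> is
  \<open>d x\<close> times \<theta>.\<close>

lemma d_D: "a \<in> carrier A \<Longrightarrow> d (D a) = d x \<otimes> \<theta> a \<oplus> D (d a)"
  using Der_mult[OF d x_homog, of "\<theta> a"] k_odd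
  by (simp add: D_def powi_minus_one_odd cycle r_minus)

lemma \<Psi>_x_mult: "a \<in> carrier A \<Longrightarrow> \<Psi> (x \<otimes> a) = x \<otimes> a"
  by (simp add: \<Psi>_def)

text \<open>Applying \<theta> to \<open>\<chi> \<ominus> x \<otimes> \<theta> \<chi>\<close>, the
  two copies of \<open>\<theta> \<chi>\<close> cancel. What is left is a multiple of
  \<open>x\<close>, which \<Psi> fixes.\<close>

lemma \<theta>_conjugate:
  assumes \<chi>: "\<chi> \<in> carrier (gen_subalg A W)"
  shows "\<Psi> (\<theta> (\<Phi> \<chi>)) = D (\<theta> \<chi>)"
proof -
  have c: "\<chi> \<in> carrier A" using gen_subalg_carrier[OF \<chi>] .
  have "\<theta> (\<Phi> \<chi>) = \<theta> \<chi> \<ominus> \<theta> (x \<otimes> \<theta> \<chi>)"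
    using c by (simp add: \<Phi>_def \<pi>_gen_subalg[OF \<chi>] D_def Der_diff[OF \<theta>])
  also have "\<dots> = D (\<theta> \<chi>)"
    using c by (simp add: \<theta>_x_mult a_minus_def minus_add r_neg2 D_def)
  finally show ?thesis using c by (simp add: D_def \<Psi>_x_mult)
qed

text \<open>By \<open>d_D\<close>, \<open>d (\<Phi> \<chi>)\<close> is \<open>d \<chi>\<close> minus
  \<open>u\<close> and \<open>D (d \<chi>)\<close>. Applying \<Psi>, \<open>remainder_D\<close>
  collapses the part from \<open>d \<chi>\<close> to \<open>\<pi> (d \<chi>)\<close> and rewrites
  the part from \<open>u\<close> as \<open>\<pi> u \<oplus> D u\<close>.\<close>

lemma d_conjugate:
  assumes \<chi>: "\<chi> \<in> carrier (gen_subalg A W)"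
  shows "\<Psi> (d (\<Phi> \<chi>)) = \<ominus> (D (\<theta> \<chi>) \<otimes> d x) \<oplus> \<pi> (d \<chi> \<ominus> d x \<otimes> \<theta> \<chi>)"
proof -
  have c: "\<chi> \<in> carrier A" using gen_subalg_carrier[OF \<chi>] .
  define u where "u = d x \<otimes> \<theta> \<chi>"
  have u: "u \<in> carrier A" using c by (simp add: u_def)
  have d\<Phi>: "d (\<Phi> \<chi>) = d \<chi> \<ominus> (u \<oplus> D (d \<chi>))"
    using c by (simp add: \<Phi>_def \<pi>_gen_subalg[OF \<chi>] Der_diff[OF d] d_D u_def)
  have "\<Psi> (d (\<Phi> \<chi>)) = d (\<Phi> \<chi>) \<oplus> (D (\<pi> (d \<chi>)) \<ominus> D (\<pi> u))"
    using c u unfolding d\<Phi>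
    by (simp add: \<Psi>_def hom_diff[OF hom] hom_add[OF hom] Der_diff[OF D_Der])
  also have "\<dots> = (d \<chi> \<ominus> D (d \<chi>) \<oplus> D (\<pi> (d \<chi>))) \<ominus> (u \<oplus> D (\<pi> u))"
    using c u unfolding d\<Phi> by (simp add: a_minus_def minus_add a_ac)
  also have "d \<chi> \<ominus> D (d \<chi>) \<oplus> D (\<pi> (d \<chi>)) = \<pi> (d \<chi>)" using c by (simp add: remainder_D)
  also have "u \<oplus> D (\<pi> u) = \<pi> u \<oplus> D u"
  proof -
    have "\<pi> u \<oplus> D u = u \<ominus> D u \<oplus> D (\<pi> u) \<oplus> D u" using remainder_D[OF u] by simp
    also have "\<dots> = u \<oplus> D (\<pi> u)" using u
      by (simp add: a_minus_def a_assoc a_comm[of "D (\<pi> u)" "D u"] r_neg1)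
    finally show ?thesis by simp
  qed
  \<comment> \<open>\<open>D\<close> is a derivation of degree 0 that kills \<open>d x\<close>, so
    it acts on the factor \<open>\<theta> \<chi>\<close> alone.\<close>
  also have "D u = D (\<theta> \<chi>) \<otimes> d x"
    using c by (simp add: u_def D_mult D_dx dx_commute)
  also have "\<pi> (d \<chi>) \<ominus> (\<pi> u \<oplus> D (\<theta> \<chi>) \<otimes> d x) = \<ominus> (D (\<theta> \<chi>) \<otimes> d x) \<oplus> \<pi> (d \<chi> \<ominus> u)"
    using c u by (simp add: hom_add[OF hom] hom_minus[OF hom] a_minus_def minus_add a_ac)
  finally show ?thesis by (simp add: u_def)
qed

lemma Der_lam: "(\<lambda>a. \<pi> (\<theta> (\<theta> a))) \<in> Der (gen_subalg A W) (2 * k)"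
  by (rule Der_\<pi>[OF Der_square[OF \<theta> k_odd]])

text \<open>As \<open>d x\<close> has degree \<open>k + 1\<close>, its product with \<theta> is a
  derivation of degree \<open>k - (k + 1)\<close>, the same as that of \<open>d\<close>.\<close>

lemma Der_d0: "(\<lambda>a. \<pi> (d a \<ominus> d x \<otimes> \<theta> a)) \<in> Der (gen_subalg A W) (-1)"
  using Der_\<pi>[OF Der_diff_closed[OF d]] Der_left_mult[OF dx_homog \<theta>] by simp

end

section \<open>The statement for minimal models\<close>

theorem theorem2p1:
  fixes A :: "'a graded_alg" and V W :: "'a set" and d \<theta> :: "'a \<Rightarrow> 'a" and x :: 'a and n :: nat
  assumes "sullivan_minimal_model A V d"
    and "gottlieb_element A V d (2 * int n + 1) x"
    and "derivation_cycle A d (2 * int n + 1) \<theta>"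
    and "\<theta> x = \<one>\<^bsub>A\<^esub>"
    and "graded_subspace A W"
    and "W \<subseteq> V"
    and "V = vspan A {x} <+>\<^bsub>A\<^esub> W"
    and "vspan A {x} \<inter> W = {\<zero>\<^bsub>A\<^esub>}"
  shows "(\<exists>!\<phi>. \<phi> \<in> extensional (carrier A) \<and> \<phi> \<in> graded_alg_aut A \<and>
            \<phi> x = x \<and> (\<forall>v \<in> W. \<phi> v = v \<ominus>\<^bsub>A\<^esub> x \<otimes>\<^bsub>A\<^esub> \<theta> v)) \<and>
    (\<forall>\<phi> d' \<theta>'. \<phi> \<in> graded_alg_aut A \<longrightarrow>
        \<phi> x = x \<longrightarrow> (\<forall>v \<in> W. \<phi> v = v \<ominus>\<^bsub>A\<^esub> x \<otimes>\<^bsub>A\<^esub> \<theta> v) \<longrightarrow>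
        d' = inv_into (carrier A) \<phi> \<circ> d \<circ> \<phi> \<longrightarrow>
        \<theta>' = inv_into (carrier A) \<phi> \<circ> \<theta> \<circ> \<phi> \<longrightarrow>
      (\<theta>' x = \<one>\<^bsub>A\<^esub> \<and> d' x = d x) \<and>
      (\<exists>lam \<in> Der (gen_subalg A W) (4 * int n + 2).
         \<forall>\<chi> \<in> carrier (gen_subalg A W). \<theta>' \<chi> = x \<otimes>\<^bsub>A\<^esub> lam \<chi>) \<and>
      (\<exists>d0 \<in> Der (gen_subalg A W) (-1). \<forall>lam \<in> Der (gen_subalg A W) (4 * int n + 2).
         (\<forall>\<chi> \<in> carrier (gen_subalg A W). \<theta>' \<chi> = x \<otimes>\<^bsub>A\<^esub> lam \<chi>) \<longrightarrow>
         (\<forall>\<chi> \<in> carrier (gen_subalg A W).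
            d' \<chi> = \<ominus>\<^bsub>A\<^esub> (\<theta>' \<chi> \<otimes>\<^bsub>A\<^esub> d x) \<oplus>\<^bsub>A\<^esub> d0 \<chi> \<and>
            d' \<chi> = \<ominus>\<^bsub>A\<^esub> (x \<otimes>\<^bsub>A\<^esub> lam \<chi> \<otimes>\<^bsub>A\<^esub> d x) \<oplus>\<^bsub>A\<^esub> d0 \<chi>)))"
proof -
  have free: "free_on A V" and V_low: "\<And>j. j < 2 \<Longrightarrow> V \<inter> homog A j = {\<zero>\<^bsub>A\<^esub>}"
    and d: "d \<in> Der A (-1)"
    using assms(1) by (auto simp only: sullivan_minimal_model_def)
  interpret free_algebra A V
    using free by (intro free_algebra.intro gc_algebra.intro free_algebra_axioms.intro)
      (simp_all add: free_on_def)
  let ?k = "2 * int n + 1"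
  have x: "x \<in> homog A ?k" using assms(2) by (simp add: gottlieb_element_def)
  interpret split_generator A V x ?k W
    by unfold_locales (use x assms(5-8) in simp_all)
  obtain \<pi> where \<pi>: "\<pi> \<in> graded_alg_hom A A" "\<pi> x = \<zero>\<^bsub>A\<^esub>" "\<And>w. w \<in> W \<Longrightarrow> \<pi> w = w"
    using ex_retraction by blast
  have \<theta>: "\<theta> \<in> Der A ?k" using assms(3) by (simp add: derivation_cycle_def)
  have cycle: "d (\<theta> a) = \<ominus>\<^bsub>A\<^esub> \<theta> (d a)" if a: "a \<in> carrier A" for a
  proof -
    have "d (\<theta> a) \<ominus>\<^bsub>A\<^esub> (- 1) powi ?k \<odot>\<^bsub>A\<^esub> \<theta> (d a) = \<zero>\<^bsub>A\<^esub>"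
      using assms(3) a by (simp add: derivation_cycle_def)
    then have "d (\<theta> a) \<oplus>\<^bsub>A\<^esub> \<theta> (d a) = \<zero>\<^bsub>A\<^esub>"
      using Der_closed[OF \<theta>] Der_closed[OF d] a
      by (simp add: powi_minus_one_odd a_minus_def)
    then show ?thesis
      using Der_closed[OF \<theta>] Der_closed[OF d] a by (metis minus_equality)
  qed
  \<comment> \<open>The lower bound on the degrees of \<open>V\<close> enters here, through
    \<open>homog_one_trivial\<close>.\<close>
  interpret gottlieb A V x ?k W \<pi> \<theta> d
    by unfold_locales (use \<pi> \<theta> d assms(4) cycle homog_one_trivial[OF V_low] in auto)
  show ?thesis
  proof (intro conjI allI impI)
    show "\<exists>!\<phi>. \<phi> \<in> extensional (carrier A) \<and> \<phi> \<in> graded_alg_aut A \<and>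
            \<phi> x = x \<and> (\<forall>v \<in> W. \<phi> v = v \<ominus>\<^bsub>A\<^esub> x \<otimes>\<^bsub>A\<^esub> \<theta> v)"
      by (rule ex1_automorphism)
  next
    fix \<phi> d' \<theta>'
    assume \<phi>: "\<phi> \<in> graded_alg_aut A" "\<phi> x = x" "\<forall>v \<in> W. \<phi> v = v \<ominus>\<^bsub>A\<^esub> x \<otimes>\<^bsub>A\<^esub> \<theta> v"
      and d': "d' = inv_into (carrier A) \<phi> \<circ> d \<circ> \<phi>"
      and \<theta>': "\<theta>' = inv_into (carrier A) \<phi> \<circ> \<theta> \<circ> \<phi>"
    have \<phi>_eq: "\<phi> a = \<Phi> a" if "a \<in> carrier A" for a
      using \<phi> that by (intro eq_\<Phi>) (auto simp: graded_alg_aut_def)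
    \<comment> \<open>On the carrier \<phi> agrees with \<Phi>, so \<open>\<Psi> b\<close> is a
      preimage of \<open>b\<close>, and injectivity makes it the one that \<open>inv_into\<close>
      selects.\<close>
    have inv: "inv_into (carrier A) \<phi> b = \<Psi> b" if "b \<in> carrier A" for b
    proof (rule inv_into_f_eq)
      show "inj_on \<phi> (carrier A)" using \<phi>(1) by (simp add: graded_alg_aut_def bij_betw_def)
    qed (use that in \<open>simp_all add: \<phi>_eq \<Phi>_\<Psi>\<close>)
    have \<theta>'_eq: "\<theta>' a = \<Psi> (\<theta> (\<Phi> a))" and d'_eq: "d' a = \<Psi> (d (\<Phi> a))" if "a \<in> carrier A" for a
      using that by (simp_all add: \<theta>' d' \<phi>_eq inv)
    show "\<theta>' x = \<one>\<^bsub>A\<^esub>"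
      by (simp add: \<theta>'_eq \<Phi>_x \<theta>_x \<Psi>_def hom_one[OF hom] Der_one[OF D_Der])
    \<comment> \<open>Here \<pi> fixes \<open>d x\<close> and \<open>D\<close> kills it, so \<Psi>
      leaves \<open>d x\<close> unchanged.\<close>
    show "d' x = d x"
      by (simp add: d'_eq \<Phi>_x \<Psi>_def \<pi>_dx D_dx)
    have \<theta>'_sub: "\<theta>' \<chi> = D (\<theta> \<chi>)" if "\<chi> \<in> carrier (gen_subalg A W)" for \<chi>
      using \<theta>'_eq[OF gen_subalg_carrier[OF that]] \<theta>_conjugate[OF that] by simp
    show "\<exists>lam \<in> Der (gen_subalg A W) (4 * int n + 2).
         \<forall>\<chi> \<in> carrier (gen_subalg A W). \<theta>' \<chi> = x \<otimes>\<^bsub>A\<^esub> lam \<chi>"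
    proof (intro bexI ballI)
      \<comment> \<open>The outer \<pi> puts the values of \<lambda> into \<Lambda>W and becomes
        invisible after multiplication by \<open>x\<close>.\<close>
      show "\<theta>' \<chi> = x \<otimes>\<^bsub>A\<^esub> \<pi> (\<theta> (\<theta> \<chi>))" if "\<chi> \<in> carrier (gen_subalg A W)" for \<chi>
        using \<theta>'_sub[OF that] gen_subalg_carrier[OF that] by (simp add: D_def x_\<pi>)
      show "(\<lambda>a. \<pi> (\<theta> (\<theta> a))) \<in> Der (gen_subalg A W) (4 * int n + 2)"
        using Der_lam by simp
    qed
    show "\<exists>d0 \<in> Der (gen_subalg A W) (-1). \<forall>lam \<in> Der (gen_subalg A W) (4 * int n + 2).
         (\<forall>\<chi> \<in> carrier (gen_subalg A W). \<theta>' \<chi> = x \<otimes>\<^bsub>A\<^esub> lam \<chi>) \<longrightarrow>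
         (\<forall>\<chi> \<in> carrier (gen_subalg A W).
            d' \<chi> = \<ominus>\<^bsub>A\<^esub> (\<theta>' \<chi> \<otimes>\<^bsub>A\<^esub> d x) \<oplus>\<^bsub>A\<^esub> d0 \<chi> \<and>
            d' \<chi> = \<ominus>\<^bsub>A\<^esub> (x \<otimes>\<^bsub>A\<^esub> lam \<chi> \<otimes>\<^bsub>A\<^esub> d x) \<oplus>\<^bsub>A\<^esub> d0 \<chi>)"
    \<comment> \<open>The witness is built from \<open>d\<close>, \<theta> and \<pi>. Since
      \<open>lam\<close> enters only through its product with \<open>x\<close>, one witness serves
      every \<open>lam\<close>.\<close>
    proof (intro bexI[OF _ Der_d0] ballI impI)
      fix lam \<chi> assume "\<forall>\<chi> \<in> carrier (gen_subalg A W). \<theta>' \<chi> = x \<otimes>\<^bsub>A\<^esub> lam \<chi>"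
        and \<chi>: "\<chi> \<in> carrier (gen_subalg A W)"
      then have lam: "x \<otimes>\<^bsub>A\<^esub> lam \<chi> = \<theta>' \<chi>" by simp
      have "d' \<chi> = \<ominus>\<^bsub>A\<^esub> (\<theta>' \<chi> \<otimes>\<^bsub>A\<^esub> d x) \<oplus>\<^bsub>A\<^esub> \<pi> (d \<chi> \<ominus>\<^bsub>A\<^esub> d x \<otimes>\<^bsub>A\<^esub> \<theta> \<chi>)"
        using d'_eq[OF gen_subalg_carrier[OF \<chi>]] d_conjugate[OF \<chi>] \<theta>'_sub[OF \<chi>] by simp
      then show "d' \<chi> = \<ominus>\<^bsub>A\<^esub> (\<theta>' \<chi> \<otimes>\<^bsub>A\<^esub> d x) \<oplus>\<^bsub>A\<^esub> \<pi> (d \<chi> \<ominus>\<^bsub>A\<^esub> d x \<otimes>\<^bsub>A\<^esub> \<theta> \<chi>) \<and>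
          d' \<chi> = \<ominus>\<^bsub>A\<^esub> (x \<otimes>\<^bsub>A\<^esub> lam \<chi> \<otimes>\<^bsub>A\<^esub> d x) \<oplus>\<^bsub>A\<^esub> \<pi> (d \<chi> \<ominus>\<^bsub>A\<^esub> d x \<otimes>\<^bsub>A\<^esub> \<theta> \<chi>)"
        by (simp add: lam)
    qed
  qed
qed

end
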